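(* Let $\kappa\leq\lambda$ be cardinals. If $\kappa$ is an internally AP $\lambda$-ineffable cardinal, then $\mathrm{ISP}(\kappa,\lambda)$ holds.
   Context: $\mathrm{H}(\theta)$ is the set of all sets whose transitive closure has cardinality less than $\theta$. An elementary embedding $j:M\to N$ between transitive classes is non-trivial if there is an ordinal $\alpha\in M$ with $j(\alpha)>\alpha$; then $\mathrm{crit}(j)$ denotes the least such ordinal. Given cardinals $\kappa<\theta$, a non-trivial elementary embedding $j:M\to \mathrm{H}(\theta)$ is a small embedding for $\kappa$ if $M\in \mathrm{H}(\theta)$ is transitive and $j(\mathrm{crit}(j))=\kappa$. "For all sufficiently large (regular) cardinals $\theta$" means: there is an ordinal $\alpha$ such that the statement holds for all (regular) cardinals $\theta>\alpha$. Given transitive classes $M\subseteq N$, the pair $(M,N)$ satisfies the $\omega_1$-approximation property if $A\in M$ whenever $A\in N$ is such that $A\subseteq B$ for some $B\in M$, and $A\cap x\in M$ for every $x\in M$ which is countable in $M$. $\mathcal{P}_\kappa(X)$ is the set of all subsets of $X$ of cardinality less than $\kappa$. A $\mathcal{P}_\kappa(\lambda)$-list is a sequence $\langle d_a\mid a\in\mathcal{P}_\kappa(\lambda)\rangle$ with $d_a\subseteq a$ for all $a$. Given cardinals $\lambda\geq\kappa$, the cardinal $\kappa$ is internally AP $\lambda$-ineffable if for all sufficiently large regular cardinals $\theta$, all $x\in \mathrm{H}(\theta)$, and every $\mathcal{P}_\kappa(\lambda)$-list $\vec d=\langle d_a\mid a\in\mathcal{P}_\kappa(\lambda)\rangle$,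 there is a small embedding $j:M\to \mathrm{H}(\theta)$ for $\kappa$, an ordinal $\delta\in M$ and a transitive model $N$ of $\mathrm{ZFC}^-$ such that $j(\delta)=\lambda$, $x,\vec d\in\mathrm{ran}(j)$, $\delta<\kappa$ and: (i) $N\subseteq \mathrm{H}(\theta)$ and the pair $(N,\mathrm{H}(\theta))$ satisfies the $\omega_1$-approximation property; (ii) $M\in N$ and $\mathcal{P}_{\omega_1}(\delta)^N\subseteq M$; (iii) if $j^{-1}[d_{j[\delta]}]\in N$, then $j^{-1}[d_{j[\delta]}]\in M$. (Here $j[\delta]$ and $j^{-1}[\,\cdot\,]$ are pointwise image and preimage.) For $\kappa$ uncountable regular and $\lambda\geq\kappa$ a cardinal, a $\mathcal{P}_\kappa(\lambda)$-list $\langle d_a\mid a\in\mathcal{P}_\kappa(\lambda)\rangle$ is slender if for every sufficiently large cardinal $\theta$, there is a club $C$ in $\mathcal{P}_\kappa(\mathrm{H}(\theta))$ with $b\cap d_{X\cap\lambda}\in X$ for all $X\in C$ and all $b\in X\cap\mathcal{P}_{\omega_1}(\lambda)$. $\mathrm{ISP}(\kappa,\lambda)$ is the statement that for every slender $\mathcal{P}_\kappa(\lambda)$-list $\langle d_a\mid a\in\mathcal{P}_\kappa(\lambda)\rangle$, there exists $D\subseteq\lambda$ such that $\{a\in\mathcal{P}_\kappa(\lambda)\mid d_a=D\cap a\}$ is stationary in $\mathcal{P}_\kappa(\lambda)$. *)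

theory Defs
  imports "HOL-Library.Equipollence" "HOL-Library.Countable_Set"
begin

section \<open>The universe of sets\<close>

text \<open>
  ZFC is rendered as a type class: a type of this class is a universe of sets, where
  \<open>elts x\<close> is the collection of elements of \<open>x\<close>. As is usual for set theory on top of HOL,
  Separation and Replacement range over arbitrary HOL predicates and functions, foundation is
  well-foundedness of membership, and the axiom of choice is inherited from HOL (a choice set
  of a set exists by Hilbert choice and Separation).
  A value of type \<open>'v\<close> is a set, a value of type \<open>'v set\<close> is a class.
\<close>

class zfc =
  fixes elts :: "'a \<Rightarrow> 'a set"
  assumes extensionality: "elts x = elts y \<Longrightarrow> x = y"
    and foundation: "wf {(x, y). x \<in> elts y}"
    and separation: "A \<subseteq> elts x \<Longrightarrow> \<exists>y. elts y = A"
    and pairing: "\<exists>y. elts y = {a, b}"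
    and union: "\<exists>y. elts y = (\<Union>z\<in>elts x. elts z)"
    and power_set: "\<exists>y. elts y = {z. elts z \<subseteq> elts x}"
    and replacement: "\<exists>y. elts y = f ` elts x"
    and infinity: "\<exists>w. (\<exists>e\<in>elts w. elts e = {}) \<and>
                       (\<forall>n\<in>elts w. \<exists>m\<in>elts w. elts m = insert n (elts n))"

text \<open>The set with a given collection of elements; meaningful only if that collection is a set.\<close>

definition coll :: "'v::zfc set \<Rightarrow> 'v" where
  "coll A = (THE x. elts x = A)"

definition opair :: "'v::zfc \<Rightarrow> 'v \<Rightarrow> 'v" where
  "opair a b = coll {coll {a}, coll {a, b}}"

text \<open>The function with domain \<open>A\<close> that is given by \<open>f\<close>, as a set of ordered pairs.\<close>

definition graph :: "'v::zfc set \<Rightarrow> ('v \<Rightarrow> 'v) \<Rightarrow> 'v" where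
  "graph A f = coll ((\<lambda>a. opair a (f a)) ` A)"

definition trans_class :: "'v::zfc set \<Rightarrow> bool" where
  "trans_class A \<longleftrightarrow> (\<forall>x\<in>A. elts x \<subseteq> A)"

definition Ord :: "'v::zfc \<Rightarrow> bool" where
  "Ord \<alpha> \<longleftrightarrow> trans_class (elts \<alpha>) \<and> (\<forall>\<beta>\<in>elts \<alpha>. trans_class (elts \<beta>))"

definition Card :: "'v::zfc \<Rightarrow> bool" where
  "Card \<kappa> \<longleftrightarrow> Ord \<kappa> \<and> (\<forall>\<alpha>\<in>elts \<kappa>. \<not> elts \<alpha> \<approx> elts \<kappa>)"

definition regular :: "'v::zfc \<Rightarrow> bool" where
  "regular \<kappa> \<longleftrightarrow> Card \<kappa> \<and> infinite (elts \<kappa>) \<and>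
     (\<forall>A. A \<subseteq> elts \<kappa> \<and> A \<prec> elts \<kappa> \<longrightarrow> (\<exists>\<beta>\<in>elts \<kappa>. A \<subseteq> elts \<beta>))"

definition omega :: "'v::zfc" where
  "omega = coll {\<alpha>. Ord \<alpha> \<and> finite (elts \<alpha>)}"

definition omega1 :: "'v::zfc" where
  "omega1 = coll {\<alpha>. Ord \<alpha> \<and> countable (elts \<alpha>)}"

definition trans_closure :: "'v::zfc \<Rightarrow> 'v set" where
  "trans_closure x = {y. (y, x) \<in> {(u, v). u \<in> elts v}\<^sup>+}"

definition H :: "'v::zfc \<Rightarrow> 'v set" where
  "H \<theta> = {x. trans_closure x \<prec> elts \<theta>}"

definition Pk :: "'v::zfc \<Rightarrow> 'v set \<Rightarrow> 'v set" where
  "Pk \<kappa> X = {a. elts a \<subseteq> X \<and> elts a \<prec> elts \<kappa>}"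


section \<open>Elementary embeddings\<close>

text \<open>Formulas of the language of set theory, with variables named by natural numbers.\<close>

datatype fm = Mem nat nat | Eq nat nat | Neg fm | And fm fm | Forall nat fm

primrec sat :: "'v::zfc set \<Rightarrow> fm \<Rightarrow> (nat \<Rightarrow> 'v) \<Rightarrow> bool" where
  "sat M (Mem m n) s \<longleftrightarrow> s m \<in> elts (s n)"
| "sat M (Eq m n) s \<longleftrightarrow> s m = s n"
| "sat M (Neg \<phi>) s \<longleftrightarrow> \<not> sat M \<phi> s"
| "sat M (And \<phi> \<psi>) s \<longleftrightarrow> sat M \<phi> s \<and> sat M \<psi> s"
| "sat M (Forall n \<phi>) s \<longleftrightarrow> (\<forall>x\<in>M. sat M \<phi> (s(n := x)))"

definition elementary :: "'v::zfc set \<Rightarrow> 'v set \<Rightarrow> ('v \<Rightarrow> 'v) \<Rightarrow> bool" where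
  "elementary M N j \<longleftrightarrow> j ` M \<subseteq> N \<and>
     (\<forall>\<phi> s. range s \<subseteq> M \<longrightarrow> (sat M \<phi> s \<longleftrightarrow> sat N \<phi> (j \<circ> s)))"

text \<open>For ordinals \<open>\<alpha>\<close> and \<open>j \<alpha>\<close>, \<open>\<alpha> \<in> elts (j \<alpha>)\<close> says that \<open>j \<alpha> > \<alpha>\<close>.\<close>

definition nontrivial :: "'v::zfc set \<Rightarrow> ('v \<Rightarrow> 'v) \<Rightarrow> bool" where
  "nontrivial M j \<longleftrightarrow> (\<exists>\<alpha>\<in>M. Ord \<alpha> \<and> \<alpha> \<in> elts (j \<alpha>))"

definition crit :: "'v::zfc set \<Rightarrow> ('v \<Rightarrow> 'v) \<Rightarrow> 'v" where
  "crit M j = (THE \<alpha>. \<alpha> \<in> M \<and> Ord \<alpha> \<and> \<alpha> \<in> elts (j \<alpha>) \<and>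
                 (\<forall>\<beta>\<in>M. Ord \<beta> \<and> \<beta> \<in> elts (j \<beta>) \<longrightarrow> \<beta> = \<alpha> \<or> \<alpha> \<in> elts \<beta>))"

definition small_embedding :: "'v::zfc \<Rightarrow> 'v \<Rightarrow> 'v \<Rightarrow> ('v \<Rightarrow> 'v) \<Rightarrow> bool" where
  "small_embedding \<kappa> \<theta> M j \<longleftrightarrow>
     Card \<kappa> \<and> Card \<theta> \<and> \<kappa> \<in> elts \<theta> \<and>
     M \<in> H \<theta> \<and> trans_class (elts M) \<and>
     elementary (elts M) (H \<theta>) j \<and> nontrivial (elts M) j \<and> j (crit (elts M) j) = \<kappa>"


section \<open>Models of ZFC without Power Set\<close>

text \<open>
  The axioms of ZFC without Power Set, relativized to \<open>N\<close>; Separation and Replacement are the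
  first-order schemes, where \<open>s\<close> supplies the parameters of the formula \<open>\<phi>\<close>. Replacement
  (rather than Collection) and Zermelo's choice-set form of the axiom of choice are used. Since
  these are the weaker forms in the absence of Power Set, models of the variants of the theory
  with Collection or the well-ordering principle are models in the sense below.
\<close>

definition ZFC_minus_model :: "'v::zfc set \<Rightarrow> bool" where
  "ZFC_minus_model N \<longleftrightarrow>
     \<comment> \<open>Extensionality\<close>
     (\<forall>x\<in>N. \<forall>y\<in>N. (\<forall>z\<in>N. z \<in> elts x \<longleftrightarrow> z \<in> elts y) \<longrightarrow> x = y) \<and>
     \<comment> \<open>Foundation\<close>
     (\<forall>x\<in>N. (\<exists>y\<in>N. y \<in> elts x) \<longrightarrow>
        (\<exists>y\<in>N. y \<in> elts x \<and> \<not> (\<exists>z\<in>N. z \<in> elts x \<and> z \<in> elts y))) \<and>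
     \<comment> \<open>Pairing\<close>
     (\<forall>a\<in>N. \<forall>b\<in>N. \<exists>y\<in>N. \<forall>z\<in>N. z \<in> elts y \<longleftrightarrow> z = a \<or> z = b) \<and>
     \<comment> \<open>Union\<close>
     (\<forall>x\<in>N. \<exists>y\<in>N. \<forall>z\<in>N. z \<in> elts y \<longleftrightarrow> (\<exists>u\<in>N. u \<in> elts x \<and> z \<in> elts u)) \<and>
     \<comment> \<open>Infinity\<close>
     (\<exists>w\<in>N. (\<exists>e\<in>N. e \<in> elts w \<and> (\<forall>z\<in>N. z \<notin> elts e)) \<and>
        (\<forall>n\<in>N. n \<in> elts w \<longrightarrow>
           (\<exists>m\<in>N. m \<in> elts w \<and> (\<forall>z\<in>N. z \<in> elts m \<longleftrightarrow> z \<in> elts n \<or> z = n)))) \<and>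
     \<comment> \<open>Separation\<close>
     (\<forall>\<phi> s. range s \<subseteq> N \<longrightarrow>
        (\<forall>a\<in>N. \<exists>b\<in>N. \<forall>x\<in>N. x \<in> elts b \<longleftrightarrow> x \<in> elts a \<and> sat N \<phi> (s(0 := x)))) \<and>
     \<comment> \<open>Replacement\<close>
     (\<forall>\<phi> s. range s \<subseteq> N \<longrightarrow>
        (\<forall>x\<in>N. \<forall>y\<in>N. \<forall>z\<in>N.
           sat N \<phi> (s(0 := x, 1 := y)) \<and> sat N \<phi> (s(0 := x, 1 := z)) \<longrightarrow> y = z) \<longrightarrow>
        (\<forall>a\<in>N. \<exists>b\<in>N. \<forall>y\<in>N.
           y \<in> elts b \<longleftrightarrow> (\<exists>x\<in>N. x \<in> elts a \<and> sat N \<phi> (s(0 := x, 1 := y))))) \<and>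
     \<comment> \<open>Choice\<close>
     (\<forall>F\<in>N.
        (\<forall>u\<in>N. u \<in> elts F \<longrightarrow> (\<exists>z\<in>N. z \<in> elts u)) \<and>
        (\<forall>u\<in>N. \<forall>v\<in>N. u \<in> elts F \<and> v \<in> elts F \<and> u \<noteq> v \<longrightarrow>
           \<not> (\<exists>z\<in>N. z \<in> elts u \<and> z \<in> elts v)) \<longrightarrow>
        (\<exists>c\<in>N. \<forall>u\<in>N. u \<in> elts F \<longrightarrow> (\<exists>!z. z \<in> N \<and> z \<in> elts u \<and> z \<in> elts c)))"


section \<open>The approximation property and internal ineffability\<close>

text \<open>
  \<open>x\<close> is countable in the transitive class \<open>M\<close>: some element of \<open>M\<close> is an injection of \<open>x\<close>
  into \<open>\<omega>\<close>. Being such an injection is absolute for transitive models.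
\<close>

definition countable_in :: "'v::zfc set \<Rightarrow> 'v \<Rightarrow> bool" where
  "countable_in M x \<longleftrightarrow>
     (\<exists>f. inj_on f (elts x) \<and> f ` elts x \<subseteq> elts omega \<and> graph (elts x) f \<in> M)"

definition omega1_approximation :: "'v::zfc set \<Rightarrow> 'v set \<Rightarrow> bool" where
  "omega1_approximation M N \<longleftrightarrow>
     (\<forall>A\<in>N. (\<exists>B\<in>M. elts A \<subseteq> elts B) \<and>
             (\<forall>x\<in>M. countable_in M x \<longrightarrow> coll (elts A \<inter> elts x) \<in> M) \<longrightarrow> A \<in> M)"

text \<open>
  The cardinal \<open>\<mu>\<close> is customarily called lambda, which is reserved syntax here.
  A list is given by a HOL function, of which only the values on \<open>Pk \<kappa> (elts \<mu>)\<close> matter; as a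
  set it is \<open>graph (Pk \<kappa> (elts \<mu>)) d\<close>.
\<close>

definition Pk_list :: "'v::zfc \<Rightarrow> 'v \<Rightarrow> ('v \<Rightarrow> 'v) \<Rightarrow> bool" where
  "Pk_list \<kappa> \<mu> d \<longleftrightarrow> (\<forall>a\<in>Pk \<kappa> (elts \<mu>). elts (d a) \<subseteq> elts a)"

text \<open>
  In the body below, \<open>coll (j ` elts \<delta>)\<close> is \<open>j[\<delta>]\<close>, and \<open>e\<close> is \<open>j\<^sup>-\<^sup>1[d\<^bsub>j[\<delta>]\<^esub>]\<close>.
\<close>

definition internally_AP_ineffable :: "'v::zfc \<Rightarrow> 'v \<Rightarrow> bool" where
  "internally_AP_ineffable \<kappa> \<mu> \<longleftrightarrow>
     (\<exists>\<alpha>. Ord \<alpha> \<and> (\<forall>\<theta>. regular \<theta> \<and> \<alpha> \<in> elts \<theta> \<longrightarrow>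
        (\<forall>x\<in>H \<theta>. \<forall>d. Pk_list \<kappa> \<mu> d \<longrightarrow>
           (\<exists>j M \<delta> N.
              small_embedding \<kappa> \<theta> M j \<and>
              Ord \<delta> \<and> \<delta> \<in> elts M \<and>
              trans_class N \<and> ZFC_minus_model N \<and>
              j \<delta> = \<mu> \<and>
              x \<in> j ` elts M \<and> graph (Pk \<kappa> (elts \<mu>)) d \<in> j ` elts M \<and>
              \<delta> \<in> elts \<kappa> \<and>
              N \<subseteq> H \<theta> \<and> omega1_approximation N (H \<theta>) \<and>
              M \<in> N \<and> {b \<in> N. elts b \<subseteq> elts \<delta> \<and> countable_in N b} \<subseteq> elts M \<and>
              (let e = coll {\<xi> \<in> elts M. j \<xi> \<in> elts (d (coll (j ` elts \<delta>)))}
               in e \<in> N \<longrightarrow> e \<in> elts M)))))"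


section \<open>Slender lists and the principle ISP\<close>

definition club :: "'v::zfc \<Rightarrow> 'v set \<Rightarrow> 'v set \<Rightarrow> bool" where
  "club \<kappa> X C \<longleftrightarrow>
     C \<subseteq> Pk \<kappa> X \<and>
     (\<forall>a\<in>Pk \<kappa> X. \<exists>c\<in>C. elts a \<subseteq> elts c) \<and>
     (\<forall>\<gamma>\<in>elts \<kappa>. \<forall>f.
        elts \<gamma> \<noteq> {} \<and> (\<forall>\<alpha>\<in>elts \<gamma>. f \<alpha> \<in> C) \<and>
        (\<forall>\<beta>\<in>elts \<gamma>. \<forall>\<alpha>\<in>elts \<beta>. elts (f \<alpha>) \<subseteq> elts (f \<beta>)) \<longrightarrow>
        coll (\<Union>\<alpha>\<in>elts \<gamma>. elts (f \<alpha>)) \<in> C)"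

definition stationary :: "'v::zfc \<Rightarrow> 'v set \<Rightarrow> 'v set \<Rightarrow> bool" where
  "stationary \<kappa> X S \<longleftrightarrow> S \<subseteq> Pk \<kappa> X \<and> (\<forall>C. club \<kappa> X C \<longrightarrow> S \<inter> C \<noteq> {})"

definition slender :: "'v::zfc \<Rightarrow> 'v \<Rightarrow> ('v \<Rightarrow> 'v) \<Rightarrow> bool" where
  "slender \<kappa> \<mu> d \<longleftrightarrow> Pk_list \<kappa> \<mu> d \<and>
     (\<exists>\<alpha>. Ord \<alpha> \<and> (\<forall>\<theta>. Card \<theta> \<and> \<alpha> \<in> elts \<theta> \<longrightarrow>
        (\<exists>C. club \<kappa> (H \<theta>) C \<and>
           (\<forall>X\<in>C. \<forall>b\<in>elts X \<inter> Pk omega1 (elts \<mu>).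
              coll (elts b \<inter> elts (d (coll (elts X \<inter> elts \<mu>)))) \<in> elts X))))"

text \<open>
  Slenderness, and hence ISP, is a notion for uncountable regular \<open>\<kappa>\<close> only; this is part of
  the assertion that the principle holds.
\<close>

definition ISP :: "'v::zfc \<Rightarrow> 'v \<Rightarrow> bool" where
  "ISP \<kappa> \<mu> \<longleftrightarrow> regular \<kappa> \<and> uncountable (elts \<kappa>) \<and>
     (\<forall>d. slender \<kappa> \<mu> d \<longrightarrow>
        (\<exists>D. elts D \<subseteq> elts \<mu> \<and>
           stationary \<kappa> (elts \<mu>) {a \<in> Pk \<kappa> (elts \<mu>). elts (d a) = elts D \<inter> elts a}))"

end

theory Submission
  imports Defs
begin

text \<open>
  The range of a small embedding \<open>j\<close> is closed under every set function that it contains, and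
  its intersection with \<open>\<kappa>\<close> is the critical point. Putting Skolem functions into the range, one
  gets that \<open>\<kappa>\<close> is regular and uncountable, that every set of size less than \<open>\<kappa>\<close> in the range
  is contained in it, and that every club in the range has an element \<open>X\<close> that is contained in
  the range, contains a prescribed small part of it, and hence can be made to satisfy
  \<open>X \<inter> \<mu> = j[\<delta>]\<close>.

  Let \<open>e = j\<^sup>-\<^sup>1[d\<^bsub>j[\<delta>]\<^esub>]\<close>. A set \<open>b = x \<inter> \<delta>\<close> with \<open>x\<close> countable in \<open>N\<close> is coded together with its
  enumeration by a countable subset of \<open>\<delta>\<close> in \<open>N\<close>; this code lies in \<open>M\<close>, so \<open>j b = j[b]\<close> is
  countable. Slenderness, applied to an \<open>X\<close> as above with \<open>j b \<in> X\<close>, puts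
  \<open>j b \<inter> d\<^bsub>j[\<delta>]\<^esub>\<close> into the range, so \<open>e \<inter> x\<close> is in \<open>N\<close>. By the approximation property \<open>e\<close> is in \<open>N\<close>,
  hence in \<open>M\<close>. Then \<open>D = j e\<close> works: otherwise the range contains a club that avoids
  \<open>{a. d\<^bsub>a\<^esub> = D \<inter> a}\<close>, and \<open>j[\<delta>]\<close> belongs to both.
\<close>

section \<open>Small classes\<close>

definition small :: "'v::zfc set \<Rightarrow> bool" where
  "small A \<longleftrightarrow> (\<exists>x. elts x = A)"

lemma elts_inject [simp]: "elts x = elts y \<longleftrightarrow> x = y"
  using extensionality by blast

lemma small_elts [simp, intro]: "small (elts x)"
  by (auto simp: small_def)

lemma coll_elts [simp]: "coll (elts x) = x"
  by (simp add: coll_def)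

lemma elts_coll [simp]: "small A \<Longrightarrow> elts (coll A) = A"
  by (auto simp: small_def)

lemma small_subset: "small B \<Longrightarrow> A \<subseteq> B \<Longrightarrow> small A"
  unfolding small_def using separation by metis

lemma small_image [simp, intro]:
  fixes f :: "'v::zfc \<Rightarrow> 'v"
  shows "small A \<Longrightarrow> small (f ` A)"
  unfolding small_def using replacement[of f] by metis

lemma small_UN [simp, intro]:
  fixes B :: "'v::zfc \<Rightarrow> 'v set"
  assumes "small A" "\<And>a. a \<in> A \<Longrightarrow> small (B a)"
  shows "small (\<Union>a\<in>A. B a)"
proof -
  obtain x where x: "elts x = (\<lambda>a. coll (B a)) ` A"
    using small_image[OF assms(1)] unfolding small_def by metis
  obtain y where "elts y = (\<Union>z\<in>elts x. elts z)"
    using union by blast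
  then have "elts y = (\<Union>a\<in>A. B a)"
    using assms(2) by (simp add: x)
  then show ?thesis
    by (auto simp: small_def)
qed

lemma small_doubleton [simp, intro]: "small {a, b}"
  using pairing by (auto simp: small_def)

lemma small_singleton [simp, intro]: "small {a}"
  using small_doubleton[of a a] by simp

lemma small_empty [simp, intro]: "small {}"
  using small_subset[OF small_singleton[of undefined]] by blast

lemma small_Un [simp, intro]: "small A \<Longrightarrow> small B \<Longrightarrow> small (A \<union> B)"
  using small_UN[of "{coll A, coll B}" elts] by simp

lemma small_insert [simp, intro]: "small A \<Longrightarrow> small (insert a A)"
  using small_Un[of "{a}" A] by simp

lemma small_Int1 [simp, intro]: "small A \<Longrightarrow> small (A \<inter> B)"
  by (erule small_subset) auto

lemma small_Pow: "small A \<Longrightarrow> small {z. elts z \<subseteq> A}"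
  unfolding small_def using power_set by metis

lemma small_lepoll:
  fixes A B :: "'v::zfc set"
  assumes "small B" "A \<lesssim> B"
  shows "small A"
proof -
  obtain g where "A \<subseteq> g ` B"
    using assms(2) by (auto simp: lepoll_iff)
  then show ?thesis
    using assms(1) small_image small_subset by blast
qed

lemma mem_not_refl [simp]: "x \<notin> elts x"
  using wf_not_refl[OF foundation, of x] by simp

lemma mem_not_sym: "x \<in> elts y \<Longrightarrow> y \<notin> elts x"
  using wf_not_sym[OF foundation, of x y] by simp

lemma mem_induct:
  assumes "\<And>x. (\<And>y. y \<in> elts x \<Longrightarrow> P y) \<Longrightarrow> P x"
  shows "P x"
  using wf_induct_rule[OF foundation, of P x] assms by blast

text \<open>Infinity provides a nonempty set closed under successors. Were it finite, its membership
  relation would be finite and acyclic, hence conversely well-founded, and some element would have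
  no successor in the set.\<close>

lemma infinite_set_exists: "\<exists>w::'v::zfc. infinite (elts w)"
proof -
  obtain w :: 'v where e: "\<exists>e\<in>elts w. elts e = {}"
    and s: "\<forall>n\<in>elts w. \<exists>m\<in>elts w. elts m = insert n (elts n)"
    using infinity by blast
  have "infinite (elts w)"
  proof
    assume fin: "finite (elts w)"
    let ?r = "{(x, y). x \<in> elts y} \<inter> elts w \<times> elts w"
    have "wf ?r"
      by (rule wf_Int1[OF foundation])
    then have "acyclic ?r"
      by (rule wf_acyclic)
    moreover have "finite ?r"
      using fin by simp
    ultimately have "wf (?r\<inverse>)"
      by (intro finite_acyclic_wf_converse)
    then obtain n where n: "n \<in> elts w" "\<And>m. (m, n) \<in> ?r\<inverse> \<Longrightarrow> m \<notin> elts w"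
      using e by (metis wfE_min)
    obtain m where "m \<in> elts w" "elts m = insert n (elts n)"
      using s n(1) by blast
    then have "(m, n) \<in> ?r\<inverse>"
      using n(1) by simp
    then show False
      using n(2) \<open>m \<in> elts w\<close> by blast
  qed
  then show ?thesis ..
qed

text \<open>Replacement collects families that are indexed by sets. An infinite set has room for the
  HOL naturals, so sequences can be collected as well.\<close>

lemma small_range_nat: "small (range (f :: nat \<Rightarrow> 'v::zfc))"
proof -
  obtain w :: 'v where "infinite (elts w)"
    using infinite_set_exists by blast
  then have "range f \<lesssim> elts w"
    by (meson image_lepoll infinite_le_lepoll lepoll_trans)
  then show ?thesis
    using small_lepoll by blast
qed

lemma opair_inject [simp]: "opair a b = opair c d \<longleftrightarrow> a = c \<and> b = d"
proof
  assume "opair a b = opair c d"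
  then have "{coll {a}, coll {a, b}} = {coll {c}, coll {c, d}}"
    unfolding opair_def by (metis elts_coll small_doubleton)
  moreover have inj: "coll {x, y} = coll {z, w} \<longleftrightarrow> {x, y} = {z, w}" for x y z w :: 'a
    by (metis elts_coll small_doubleton)
  have "coll {x} = coll {z, w} \<longleftrightarrow> x = z \<and> x = w" "coll {x, y} = coll {z} \<longleftrightarrow> x = z \<and> y = z"
    "coll {x} = coll {z} \<longleftrightarrow> x = z"
    for x y z w :: 'a
    using inj[of x x z w] inj[of x y z z] inj[of x x z z] by (auto simp: doubleton_eq_iff)
  ultimately show "a = c \<and> b = d"
    by (auto simp: doubleton_eq_iff inj)
qed simp

lemma elts_opair: "elts (opair a b) = {coll {a}, coll {a, b}}"
  by (simp add: opair_def)

definition opair_fst :: "'v::zfc \<Rightarrow> 'v" where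
  "opair_fst p = (THE a. \<exists>b. p = opair a b)"

definition opair_snd :: "'v::zfc \<Rightarrow> 'v" where
  "opair_snd p = (THE b. \<exists>a. p = opair a b)"

lemma opair_fst_opair [simp]: "opair_fst (opair a b) = a"
  by (auto simp: opair_fst_def)

lemma opair_snd_opair [simp]: "opair_snd (opair a b) = b"
  by (auto simp: opair_snd_def)

lemma small_opairs: "small A \<Longrightarrow> small B \<Longrightarrow> small (\<Union>a\<in>A. opair a ` B)"
  by (intro small_UN small_image)

lemma opair_in_graph [simp]: "small A \<Longrightarrow> opair a b \<in> elts (graph A f) \<longleftrightarrow> a \<in> A \<and> b = f a"
  by (auto simp: graph_def)

lemma graph_cases:
  assumes "small A" "p \<in> elts (graph A f)"
  obtains a where "a \<in> A" "p = opair a (f a)"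
  using assms by (auto simp: graph_def)

text \<open>One closure step is iterated along the natural numbers. Each stage stays small because
  \<open>fs\<close> is a finite list, and since the stages increase, the two arguments of
  \<open>opair\<close> occur at a common stage.\<close>

lemma small_closure:
  fixes A :: "'v::zfc set"
  assumes "small A"
  obtains U :: 'v where "A \<subseteq> elts U"
    "\<And>f a. f \<in> set fs \<Longrightarrow> a \<in> elts U \<Longrightarrow> f a \<in> elts U"
    "\<And>a b. a \<in> elts U \<Longrightarrow> b \<in> elts U \<Longrightarrow> opair a b \<in> elts U"
proof -
  define step where "step S = S \<union> (\<Union>f\<in>set fs. f ` S) \<union> (\<Union>a\<in>S. opair a ` S)" for S :: "'v set"
  define V where "V n = (step ^^ n) A" for n
  have small_fs: "small (\<Union>f\<in>set fs. f ` S)" if "small S" for S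
    using that by (induction fs) auto
  have small_V: "small (V n)" for n
    using assms by (induction n) (auto simp: V_def step_def small_fs)
  have V_Suc: "V (Suc n) = step (V n)" for n
    by (simp add: V_def)
  have "small (\<Union>n. V n)"
    using small_UN[OF small_range_nat[of "\<lambda>n. coll (V n)"], of elts] small_V by simp
  moreover have mono: "V m \<subseteq> V n" if "m \<le> n" for m n
    using that by (rule lift_Suc_mono_le[rotated]) (auto simp: V_Suc step_def)
  moreover have "opair a b \<in> (\<Union>n. V n)" if ab: "a \<in> (\<Union>n. V n)" "b \<in> (\<Union>n. V n)" for a b
  proof -
    from ab obtain m n where "a \<in> V m" "b \<in> V n"
      by blast
    then have "a \<in> V (max m n)" "b \<in> V (max m n)"
      using mono[of m "max m n"] mono[of n "max m n"] by auto
    then have "opair a b \<in> V (Suc (max m n))"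
      by (auto simp: V_Suc step_def)
    then show ?thesis
      by blast
  qed
  moreover have "f a \<in> (\<Union>n. V n)" if fa: "f \<in> set fs" "a \<in> (\<Union>n. V n)" for f a
  proof -
    from fa obtain n where "a \<in> V n"
      by blast
    then have "f a \<in> V (Suc n)"
      using fa by (auto simp: V_Suc step_def)
    then show ?thesis
      by blast
  qed
  moreover have "A \<subseteq> (\<Union>n. V n)"
    by (rule subset_trans[OF _ UN_upper[of 0]]) (simp_all add: V_def)
  ultimately show thesis
    using that[of "coll (\<Union>n. V n)"] by simp
qed


section \<open>Ordinals and cardinals\<close>

lemma Ord_trans: "Ord \<alpha> \<Longrightarrow> \<beta> \<in> elts \<alpha> \<Longrightarrow> elts \<beta> \<subseteq> elts \<alpha>"
  by (auto simp: Ord_def trans_class_def)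

lemma Ord_in_Ord: "Ord \<alpha> \<Longrightarrow> \<beta> \<in> elts \<alpha> \<Longrightarrow> Ord \<beta>"
  by (meson Ord_def Ord_trans subsetD)

lemma Ord_eltsI:
  assumes "trans_class (elts x)" "\<And>y. y \<in> elts x \<Longrightarrow> Ord y"
  shows "Ord x"
  using assms by (auto simp: Ord_def)

text \<open>Nested membership induction: if \<open>\<alpha>\<close> and \<open>\<beta>\<close> were
  incomparable, the two induction hypotheses would give them the same elements.\<close>

lemma Ord_linear:
  assumes "Ord \<alpha>" "Ord \<beta>"
  shows "\<alpha> \<in> elts \<beta> \<or> \<alpha> = \<beta> \<or> \<beta> \<in> elts \<alpha>"
  using assms
proof (induction \<alpha> arbitrary: \<beta> rule: mem_induct)
  case (1 \<alpha>)
  note IH = 1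
  show ?case
    using IH(3)
  proof (induction \<beta> rule: mem_induct)
    case (1 \<beta>)
    show ?case
    proof (rule ccontr)
      assume neg: "\<not> ?case"
      have "elts \<alpha> \<subseteq> elts \<beta>"
        using IH(1)[OF _ Ord_in_Ord[OF IH(2)] \<open>Ord \<beta>\<close>] Ord_trans[OF IH(2)] neg by blast
      moreover have "elts \<beta> \<subseteq> elts \<alpha>"
        using "1.IH" Ord_in_Ord[OF \<open>Ord \<beta>\<close>] Ord_trans[OF \<open>Ord \<beta>\<close>] neg by blast
      ultimately show False
        using neg by auto
    qed
  qed
qed

lemma Ord_subset_iff:
  assumes "Ord \<alpha>" "Ord \<beta>"
  shows "elts \<alpha> \<subseteq> elts \<beta> \<longleftrightarrow> \<alpha> \<in> elts \<beta> \<or> \<alpha> = \<beta>"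
  using Ord_linear[OF assms] Ord_trans[OF assms(2)] mem_not_refl by blast

lemma Ord_least:
  assumes "P \<alpha>" "Ord \<alpha>"
  obtains \<beta> where "P \<beta>" "Ord \<beta>" "\<And>\<gamma>. P \<gamma> \<Longrightarrow> Ord \<gamma> \<Longrightarrow> \<beta> = \<gamma> \<or> \<beta> \<in> elts \<gamma>"
proof -
  obtain \<beta> where \<beta>: "P \<beta>" "Ord \<beta>" "\<And>\<gamma>. \<gamma> \<in> elts \<beta> \<Longrightarrow> \<not> (P \<gamma> \<and> Ord \<gamma>)"
  proof (rule ccontr)
    assume neg: "\<not> thesis"
    have "\<not> (P \<beta> \<and> Ord \<beta>)" for \<beta>
      by (induction \<beta> rule: mem_induct) (use neg that in auto)
    then show False
      using assms by simp
  qed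
  show thesis
  proof (rule that[OF \<beta>(1,2)])
    fix \<gamma> assume "P \<gamma>" "Ord \<gamma>"
    then show "\<beta> = \<gamma> \<or> \<beta> \<in> elts \<gamma>"
      using \<beta>(2,3) Ord_linear[of \<beta> \<gamma>] by blast
  qed
qed

text \<open>This is the strict supremum of \<open>A\<close>, which later serves as the bound that
  regularity asks for.\<close>

lemma Ord_coll_UN_succ:
  assumes "small A" "\<And>\<alpha>. \<alpha> \<in> A \<Longrightarrow> Ord \<alpha>"
  shows "Ord (coll (\<Union>\<alpha>\<in>A. insert \<alpha> (elts \<alpha>)))"
proof (rule Ord_eltsI)
  have sm: "small (\<Union>\<alpha>\<in>A. insert \<alpha> (elts \<alpha>))"
    using assms(1) by (rule small_UN) auto
  show "trans_class (elts (coll (\<Union>\<alpha>\<in>A. insert \<alpha> (elts \<alpha>))))"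
    unfolding elts_coll[OF sm] trans_class_def using assms(2) Ord_trans by blast
  fix y assume "y \<in> elts (coll (\<Union>\<alpha>\<in>A. insert \<alpha> (elts \<alpha>)))"
  then show "Ord y"
    unfolding elts_coll[OF sm] using assms(2) Ord_in_Ord by blast
qed

text \<open>Link to the cardinal orders of HOL, from which comparability and infinite cardinal
  arithmetic are carried over.\<close>

lemma lepoll_iff_ordLeq: "A \<lesssim> B \<longleftrightarrow> ordLeq3 (card_of A) (card_of B)"
  by (auto simp: lepoll_def card_of_ordLeq)

lemma not_lepoll_iff: "\<not> A \<lesssim> B \<longleftrightarrow> B \<prec> A"
  unfolding lesspoll_def
  by (metis card_of_Well_order eqpoll_imp_lepoll eqpoll_sym lepoll_antisym lepoll_iff_ordLeq ordLeq_total)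

lemma lesspoll_iff_ordLess: "A \<prec> B \<longleftrightarrow> ordLess2 (card_of A) (card_of B)"
  by (metis card_of_Well_order lepoll_iff_ordLeq not_lepoll_iff not_ordLeq_iff_ordLess)

lemma Un_lesspoll: "infinite C \<Longrightarrow> A \<prec> C \<Longrightarrow> B \<prec> C \<Longrightarrow> A \<union> B \<prec> C"
  by (simp add: lesspoll_iff_ordLess card_of_Un_ordLess_infinite)

lemma insert_lesspoll:
  assumes "infinite C" "A \<prec> C"
  shows "insert a A \<prec> C"
  using Un_lesspoll[OF assms(1) _ assms(2), of "{a}"] assms(1)
  by (simp add: finite_lesspoll_infinite)

lemma UN_lepoll_infinite:
  assumes "infinite C" "A \<lesssim> C" "\<And>a. a \<in> A \<Longrightarrow> B a \<lesssim> C"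
  shows "(\<Union>a\<in>A. B a) \<lesssim> C"
  using assms by (simp add: lepoll_iff_ordLeq card_of_UNION_ordLeq_infinite)

lemma subset_lesspoll: "A \<subseteq> B \<Longrightarrow> B \<prec> C \<Longrightarrow> A \<prec> C"
  using lesspoll_trans1 subset_imp_lepoll by blast

text \<open>
  Compare the cardinal of \<open>A\<close> with the well-order of \<open>\<alpha>\<close>: it is isomorphic to a proper initial
  segment, which is an element of \<open>\<alpha>\<close>.
\<close>

lemma lesspoll_Ord_eqpoll:
  assumes "Ord \<alpha>" "A \<prec> elts \<alpha>"
  obtains \<gamma> where "\<gamma> \<in> elts \<alpha>" "A \<approx> elts \<gamma>"
proof -
  define r where "r = {(\<beta>, \<gamma>). \<beta> \<in> elts \<alpha> \<and> \<gamma> \<in> elts \<alpha> \<and> (\<beta> \<in> elts \<gamma> \<or> \<beta> = \<gamma>)}"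
  have Field: "Field r = elts \<alpha>"
    by (auto simp: r_def Field_def)
  have wf: "wf (r - Id)"
    by (rule wf_subset[OF foundation]) (auto simp: r_def)
  have Ord: "Ord \<beta>" if "\<beta> \<in> elts \<alpha>" for \<beta>
    using that assms(1) Ord_in_Ord by blast
  have "trans r"
    unfolding trans_def r_def using Ord Ord_trans by blast
  moreover have "antisym r"
    unfolding antisym_def r_def using mem_not_sym by blast
  moreover have "total_on (elts \<alpha>) r"
    unfolding total_on_def r_def using Ord Ord_linear by blast
  moreover have "refl_on (elts \<alpha>) r"
    by (auto simp: refl_on_def r_def)
  moreover have "r \<subseteq> elts \<alpha> \<times> elts \<alpha>"
    by (auto simp: r_def)
  ultimately have wo: "Well_order r"
    unfolding well_order_on_def linear_order_on_def partial_order_on_def preorder_on_def Field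
    using wf by blast
  have "ordLeq3 (card_of (elts \<alpha>)) r"
    using card_of_least[of "elts \<alpha>" r] wo Field by simp
  moreover have "\<not> ordLeq3 (card_of (elts \<alpha>)) (card_of A)"
    using assms(2) not_lepoll_iff[of "elts \<alpha>" A] by (simp add: lepoll_iff_ordLeq)
  ultimately have "\<not> ordLeq3 r (card_of A)"
    using ordLeq_transitive by blast
  then have "ordLess2 (card_of A) r"
    using wo not_ordLeq_iff_ordLess card_of_Well_order by blast
  then obtain \<gamma> where \<gamma>: "\<gamma> \<in> elts \<alpha>" and iso: "ordIso2 (card_of A) (Restr r (underS r \<gamma>))"
    using ordLess_iff_ordIso_Restr[OF wo card_of_Well_order] Field by blast
  have "underS r \<gamma> = elts \<gamma>"
    using \<gamma> Ord_trans[OF assms(1)] mem_not_refl by (auto simp: underS_def r_def)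
  moreover have "Field (Restr r (elts \<gamma>)) = elts \<gamma>"
    using \<gamma> Ord_trans[OF assms(1) \<gamma>] by (auto simp: Field_def r_def)
  ultimately have "ordIso2 (card_of A) (card_of (elts \<gamma>))"
    using card_of_cong[OF iso] by (simp add: Field_card_of)
  then show thesis
    using that \<gamma> eqpoll_iff_card_of_ordIso by blast
qed

lemma Card_mem_lesspoll: "Card \<kappa> \<Longrightarrow> \<alpha> \<in> elts \<kappa> \<Longrightarrow> elts \<alpha> \<prec> elts \<kappa>"
  by (simp add: Card_def lesspoll_def Ord_trans subset_imp_lepoll)

text \<open>An ordinal injecting into \<open>A\<close> is recovered from the image of its membership order.\<close>

lemma small_Hartogs:
  fixes A :: "'v::zfc set"
  assumes "small A"
  shows "small {\<alpha>::'v. Ord \<alpha> \<and> elts \<alpha> \<lesssim> A}"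
proof -
  \<comment> \<open>The order is coded reflexively: the strict order is empty for both 0 and 1,
    whereas here the image of \<open>f\<close> can be read off as the diagonal of the code.\<close>
  define rel where "rel \<alpha> f = {opair (f \<beta>) (f \<gamma>) |\<beta> \<gamma>. \<beta> \<in> elts \<alpha> \<and> \<gamma> \<in> elts \<alpha> \<and> (\<beta> \<in> elts \<gamma> \<or> \<beta> = \<gamma>)}"
    for \<alpha> :: 'v and f :: "'v \<Rightarrow> 'v"
  define good where "good r \<alpha> \<longleftrightarrow> Ord \<alpha> \<and> (\<exists>f. inj_on f (elts \<alpha>) \<and> f ` elts \<alpha> \<subseteq> A \<and> elts r = rel \<alpha> f)"
    for r \<alpha> :: 'v
  let ?P = "{r. elts r \<subseteq> (\<Union>a\<in>A. opair a ` A)}"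
  have unique: "\<alpha> = \<alpha>'" if good: "good r \<alpha>" "good r \<alpha>'" for r \<alpha> \<alpha>'
  proof -
    obtain f where Ord: "Ord \<alpha>" and f: "inj_on f (elts \<alpha>)" "elts r = rel \<alpha> f"
      using good(1) by (auto simp: good_def)
    obtain g where Ord': "Ord \<alpha>'" and g: "inj_on g (elts \<alpha>')" "elts r = rel \<alpha>' g"
      using good(2) by (auto simp: good_def)
    have f_iff: "opair (f \<beta>) (f \<gamma>) \<in> elts r \<longleftrightarrow> \<beta> \<in> elts \<gamma> \<or> \<beta> = \<gamma>"
      if "\<beta> \<in> elts \<alpha>" "\<gamma> \<in> elts \<alpha>" for \<beta> \<gamma>
      using that f by (auto simp: rel_def dest: inj_onD)
    have g_iff: "opair (g \<beta>) (g \<gamma>) \<in> elts r \<longleftrightarrow> \<beta> \<in> elts \<gamma> \<or> \<beta> = \<gamma>"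
      if "\<beta> \<in> elts \<alpha>'" "\<gamma> \<in> elts \<alpha>'" for \<beta> \<gamma>
      using that g by (auto simp: rel_def dest: inj_onD)
    have image_f: "f ` elts \<alpha> = {a. opair a a \<in> elts r}"
      using f by (auto simp: rel_def dest: inj_onD)
    have image_g: "g ` elts \<alpha>' = {a. opair a a \<in> elts r}"
      using g by (auto simp: rel_def dest: inj_onD)
    \<comment> \<open>The two injections agree by induction: the elements of \<open>\<alpha>\<close>
      and of \<open>\<alpha>'\<close> that are sent to the same point of the code have the same
      elements themselves.\<close>
    have agree: "\<beta> \<in> elts \<alpha>' \<and> g \<beta> = f \<beta>" if "\<beta> \<in> elts \<alpha>" for \<beta>
      using that
    proof (induction \<beta> rule: mem_induct)
      case (1 \<beta>)
      have sub: "elts \<beta> \<subseteq> elts \<alpha>"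
        using 1 Ord Ord_trans by blast
      obtain \<beta>' where \<beta>': "\<beta>' \<in> elts \<alpha>'" "f \<beta> = g \<beta>'"
        using image_f image_g 1 by blast
      have sub': "elts \<beta>' \<subseteq> elts \<alpha>'"
        using \<beta>' Ord' Ord_trans by blast
      have "elts \<beta> \<subseteq> elts \<beta>'"
      proof
        fix \<gamma> assume \<gamma>: "\<gamma> \<in> elts \<beta>"
        then have *: "\<gamma> \<in> elts \<alpha>'" "g \<gamma> = f \<gamma>"
          using 1 sub by auto
        then have "opair (g \<gamma>) (g \<beta>') \<in> elts r"
          using f_iff[of \<gamma> \<beta>] \<gamma> sub 1 \<beta>' by auto
        then have "\<gamma> \<in> elts \<beta>' \<or> \<gamma> = \<beta>'"
          using g_iff * \<beta>' by blast
        moreover have "\<gamma> \<noteq> \<beta>'"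
          using * \<beta>' f(1) \<gamma> sub 1 by (metis inj_onD mem_not_refl subsetD)
        ultimately show "\<gamma> \<in> elts \<beta>'"
          by blast
      qed
      moreover have "elts \<beta>' \<subseteq> elts \<beta>"
      proof
        fix \<gamma>' assume \<gamma>': "\<gamma>' \<in> elts \<beta>'"
        then have \<gamma>'2: "\<gamma>' \<in> elts \<alpha>'"
          using sub' by blast
        then obtain \<gamma> where \<gamma>: "\<gamma> \<in> elts \<alpha>" "f \<gamma> = g \<gamma>'"
          using image_f image_g by (metis (no_types, lifting) imageE image_eqI)
        have "opair (f \<gamma>) (f \<beta>) \<in> elts r"
          using g_iff[of \<gamma>' \<beta>'] \<gamma>' \<gamma>'2 \<beta>' \<gamma> by auto
        then have "\<gamma> \<in> elts \<beta> \<or> \<gamma> = \<beta>"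
          using f_iff \<gamma> 1 by blast
        moreover have "\<gamma> \<noteq> \<beta>"
          using \<gamma> \<beta>' g(1) \<gamma>' \<gamma>'2 by (metis inj_onD mem_not_refl)
        ultimately have "\<gamma> \<in> elts \<beta>"
          by blast
        then have "\<gamma> \<in> elts \<alpha>'" "g \<gamma> = g \<gamma>'"
          using 1 \<gamma> by auto
        then have "\<gamma> = \<gamma>'"
          using g(1) \<gamma>'2 by (meson inj_onD)
        then show "\<gamma>' \<in> elts \<beta>"
          using \<open>\<gamma> \<in> elts \<beta>\<close> by simp
      qed
      ultimately have "\<beta> = \<beta>'"
        by (metis elts_inject subset_antisym)
      then show ?case
        using \<beta>' by simp
    qed
    then have "elts \<alpha> \<subseteq> elts \<alpha>'"
      by blast
    moreover have "elts \<alpha>' \<subseteq> elts \<alpha>"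
    proof
      fix \<gamma>' assume "\<gamma>' \<in> elts \<alpha>'"
      moreover obtain \<gamma> where "\<gamma> \<in> elts \<alpha>" "f \<gamma> = g \<gamma>'"
        using image_f image_g \<open>\<gamma>' \<in> elts \<alpha>'\<close> by (metis (no_types, lifting) imageE image_eqI)
      ultimately show "\<gamma>' \<in> elts \<alpha>"
        using agree g(1) by (metis inj_onD)
    qed
    ultimately show ?thesis
      by (metis elts_inject subset_antisym)
  qed
  have "{\<alpha>. Ord \<alpha> \<and> elts \<alpha> \<lesssim> A} \<subseteq> (\<lambda>r. THE \<alpha>. good r \<alpha>) ` ?P"
  proof
    fix \<alpha> :: 'v assume "\<alpha> \<in> {\<alpha>. Ord \<alpha> \<and> elts \<alpha> \<lesssim> A}"
    then obtain f where f: "Ord \<alpha>" "inj_on f (elts \<alpha>)" "f ` elts \<alpha> \<subseteq> A"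
      by (auto simp: lepoll_def)
    have sub: "rel \<alpha> f \<subseteq> (\<Union>a\<in>A. opair a ` A)"
      using f(3) by (auto simp: rel_def)
    then have elts: "elts (coll (rel \<alpha> f)) = rel \<alpha> f"
      using small_subset[OF small_opairs[OF assms assms]] by simp
    have "good (coll (rel \<alpha> f)) \<alpha>"
      unfolding good_def using f elts by blast
    then have "(THE \<alpha>'. good (coll (rel \<alpha> f)) \<alpha>') = \<alpha>"
      using unique by (metis the_equality)
    moreover have "coll (rel \<alpha> f) \<in> ?P"
      using sub elts by simp
    ultimately show "\<alpha> \<in> (\<lambda>r. THE \<alpha>. good r \<alpha>) ` ?P"
      by (metis image_eqI)
  qed
  moreover have "small ?P"
    using small_Pow[OF small_opairs[OF assms assms]] by simp
  ultimately show ?thesis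
    using small_image small_subset by blast
qed

text \<open>\<open>\<theta>\<close> is the Hartogs number of an infinite set \<open>B\<close> that
  includes \<open>A\<close>. A union of at most |B| sets of size at most |B| has size at most |B|,
  so the strict supremum of fewer than \<open>\<theta>\<close> elements stays below
  \<open>\<theta>\<close>.\<close>

lemma regular_exists:
  fixes A :: "'v::zfc set"
  assumes "small A"
  obtains \<theta> :: 'v where "regular \<theta>" "A \<prec> elts \<theta>" "\<And>\<alpha>. Ord \<alpha> \<Longrightarrow> elts \<alpha> \<subseteq> A \<Longrightarrow> \<alpha> \<in> elts \<theta>"
proof -
  obtain w :: 'v where w: "infinite (elts w)"
    using infinite_set_exists by blast
  define B where "B = A \<union> elts w"
  have inf: "infinite B"
    using w by (simp add: B_def)
  have sm: "small {\<alpha>::'v. Ord \<alpha> \<and> elts \<alpha> \<lesssim> B}"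
    unfolding B_def by (intro small_Hartogs small_Un assms small_elts)
  define \<theta> :: 'v where "\<theta> = coll {\<alpha>. Ord \<alpha> \<and> elts \<alpha> \<lesssim> B}"
  have \<theta>: "\<alpha> \<in> elts \<theta> \<longleftrightarrow> Ord \<alpha> \<and> elts \<alpha> \<lesssim> B" for \<alpha>
    unfolding \<theta>_def elts_coll[OF sm] by simp
  have "Ord \<theta>"
  proof (rule Ord_eltsI)
    show "trans_class (elts \<theta>)"
      unfolding trans_class_def
    proof (intro ballI subsetI)
      fix \<alpha> \<beta> assume "\<alpha> \<in> elts \<theta>" and \<beta>: "\<beta> \<in> elts \<alpha>"
      then have \<alpha>: "Ord \<alpha>" "elts \<alpha> \<lesssim> B"
        by (simp_all add: \<theta>)
      then have "elts \<beta> \<lesssim> B"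
        using Ord_trans[OF \<alpha>(1) \<beta>] by (meson lepoll_trans subset_imp_lepoll)
      then show "\<beta> \<in> elts \<theta>"
        using Ord_in_Ord[OF \<alpha>(1) \<beta>] by (simp add: \<theta>)
    qed
  qed (simp add: \<theta>)
  then have not: "\<not> elts \<theta> \<lesssim> B"
    using \<theta>[of \<theta>] by simp
  then have B: "B \<prec> elts \<theta>"
    by (simp add: not_lepoll_iff)
  have inf\<theta>: "infinite (elts \<theta>)"
    using not inf finite_lepoll_infinite by blast
  have "Card \<theta>"
    unfolding Card_def using \<open>Ord \<theta>\<close> not \<theta> by (meson eqpoll_sym lepoll_trans1)
  have "\<exists>\<beta>\<in>elts \<theta>. X \<subseteq> elts \<beta>" if X: "X \<subseteq> elts \<theta>" "X \<prec> elts \<theta>" for X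
  proof -
    obtain \<gamma> where "\<gamma> \<in> elts \<theta>" "X \<approx> elts \<gamma>"
      using lesspoll_Ord_eqpoll \<open>Ord \<theta>\<close> X(2) by blast
    then have XB: "X \<lesssim> B"
      using \<theta> by (meson lepoll_trans1)
    have smX: "small X"
      by (rule small_subset[OF small_elts X(1)])
    have smU: "small (\<Union>\<alpha>\<in>X. insert \<alpha> (elts \<alpha>))"
      using smX by (rule small_UN) auto
    let ?\<beta> = "coll (\<Union>\<alpha>\<in>X. insert \<alpha> (elts \<alpha>))"
    have "(\<Union>\<alpha>\<in>X. insert \<alpha> (elts \<alpha>)) \<lesssim> B"
    proof (rule UN_lepoll_infinite[OF inf XB])
      fix \<alpha> assume "\<alpha> \<in> X"
      then have "elts \<alpha> \<lesssim> B"
        using X \<theta> by blast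
      then show "insert \<alpha> (elts \<alpha>) \<lesssim> B"
        using infinite_insert_eqpoll[OF inf, of \<alpha>] inf
        by (metis finite_insert finite_lepoll_infinite infinite_insert_lepoll lepoll_trans)
    qed
    then have "?\<beta> \<in> elts \<theta>"
      using \<theta> Ord_coll_UN_succ[OF smX] X(1) smU by auto
    moreover have "X \<subseteq> elts ?\<beta>"
      unfolding elts_coll[OF smU] by blast
    ultimately show ?thesis
      by blast
  qed
  then have "regular \<theta>"
    unfolding regular_def using \<open>Card \<theta>\<close> inf\<theta> by blast
  moreover have "A \<prec> elts \<theta>"
    using B subset_lesspoll[of A B] by (simp add: B_def)
  moreover have "\<alpha> \<in> elts \<theta>" if "Ord \<alpha>" "elts \<alpha> \<subseteq> A" for \<alpha>
    unfolding \<theta> using that subset_imp_lepoll[of "elts \<alpha>" B] by (auto simp: B_def)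
  ultimately show thesis
    using that by blast
qed

lemma elts_omega: "elts (omega :: 'v::zfc) = {\<alpha>. Ord \<alpha> \<and> finite (elts \<alpha>)}"
proof -
  obtain w :: 'v where "infinite (elts w)"
    using infinite_set_exists by blast
  then have "{\<alpha>::'v. Ord \<alpha> \<and> finite (elts \<alpha>)} \<subseteq> {\<alpha>. Ord \<alpha> \<and> elts \<alpha> \<lesssim> elts w}"
    using finite_lepoll_infinite by blast
  then show ?thesis
    unfolding omega_def using small_Hartogs small_subset by (intro elts_coll) blast
qed

lemma countable_omega: "countable (elts (omega :: 'v::zfc))"
proof (rule countableI)
  show "inj_on (\<lambda>\<alpha>. card (elts \<alpha>)) (elts (omega :: 'v))"
  proof (rule inj_onI)
    fix \<alpha> \<beta> :: 'v
    assume "\<alpha> \<in> elts omega" "\<beta> \<in> elts omega" and card: "card (elts \<alpha>) = card (elts \<beta>)"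
    then have Ord: "Ord \<alpha>" "Ord \<beta>" and fin: "finite (elts \<alpha>)" "finite (elts \<beta>)"
      by (auto simp: elts_omega)
    show "\<alpha> = \<beta>"
      using Ord_linear[OF Ord] Ord_trans Ord card card_subset_eq fin by (metis elts_inject)
  qed
qed

text \<open>If \<open>omega\<close> were finite, it would be a finite ordinal and thus an element of
  itself.\<close>

lemma infinite_omega: "infinite (elts (omega :: 'v::zfc))"
proof
  assume "finite (elts (omega :: 'v))"
  moreover have "Ord (omega :: 'v)"
    by (rule Ord_eltsI)
      (auto simp: elts_omega trans_class_def dest: Ord_in_Ord Ord_trans intro: finite_subset)
  ultimately show False
    using mem_not_refl[of "omega :: 'v"] by (simp add: elts_omega)
qed

text \<open>A countable \<open>omega1\<close> would be a countable ordinal and thus an element of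
  itself; comparability of cardinalities does the rest.\<close>

lemma countable_lesspoll_omega1:
  fixes A :: "'v::zfc set"
  assumes "countable A"
  shows "A \<prec> elts (omega1 :: 'v)"
proof -
  have "countable B \<longleftrightarrow> B \<lesssim> elts (omega :: 'v)" for B :: "'v set"
    by (metis countable_lepoll countable_omega infinite_omega countable_def infinite_le_lepoll
        lepoll_def lepoll_trans subset_UNIV)
  then have "small {\<alpha>::'v. Ord \<alpha> \<and> countable (elts \<alpha>)}"
    using small_Hartogs[of "elts omega"] by simp
  then have elts: "elts (omega1 :: 'v) = {\<alpha>. Ord \<alpha> \<and> countable (elts \<alpha>)}"
    unfolding omega1_def by (rule elts_coll)
  have "Ord (omega1 :: 'v)"
    by (rule Ord_eltsI)
      (auto simp: elts trans_class_def dest: Ord_in_Ord Ord_trans intro: countable_subset)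
  then have "uncountable (elts (omega1 :: 'v))"
    using mem_not_refl[of "omega1 :: 'v"] elts by blast
  then show ?thesis
    using assms countable_lepoll not_lepoll_iff by blast
qed

text \<open>Through this bijection an enumeration of a subset of \<open>\<mu>\<close> by natural
  numbers can be coded as a subset of \<open>\<mu>\<close>.\<close>

lemma bij_betw_times_omega:
  assumes "infinite (elts \<mu>)"
  obtains p :: "'v::zfc \<Rightarrow> 'v \<times> 'v" where "bij_betw p (elts \<mu>) (elts \<mu> \<times> elts omega)"
proof -
  have "elts (omega :: 'v) \<lesssim> elts \<mu>"
    using assms countable_omega
    by (metis countable_def infinite_le_lepoll lepoll_def lepoll_trans subset_UNIV)
  then have "elts \<mu> \<approx> elts \<mu> \<times> elts (omega :: 'v)"
    using card_of_Times_infinite_simps(2)[OF assms, of "elts (omega :: 'v)"]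
      infinite_imp_nonempty[OF infinite_omega]
    by (simp add: eqpoll_iff_card_of_ordIso lepoll_iff_ordLeq)
  then show thesis
    using that by (auto simp: eqpoll_def)
qed


section \<open>Directed subfamilies of clubs\<close>

text \<open>
  A monotone choice \<open>F\<close> of elements of \<open>\<D>\<close> above the finite subsets of \<open>A\<close> presents a directed
  union of length less than \<open>\<kappa>\<close>; by induction on the cardinality of \<open>B\<close> the union of the
  \<open>F e\<close> over finite \<open>e \<subseteq> B\<close> is decomposed into chains.
\<close>

lemma club_directed:
  fixes \<kappa> :: "'v::zfc"
  assumes club: "club \<kappa> X C" and Card: "Card \<kappa>"
    and \<D>: "\<D> \<subseteq> C" "\<D> \<noteq> {}"
    and dir: "\<And>c c'. c \<in> \<D> \<Longrightarrow> c' \<in> \<D> \<Longrightarrow> \<exists>c''\<in>\<D>. elts c \<union> elts c' \<subseteq> elts c''"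
    and A: "A \<subseteq> (\<Union>c\<in>\<D>. elts c)" "A \<prec> elts \<kappa>"
  obtains Y where "Y \<in> C" "A \<subseteq> elts Y" "elts Y \<subseteq> (\<Union>c\<in>\<D>. elts c)"
proof -
  have bound: "\<exists>c\<in>\<D>. (\<Union>x\<in>S. elts x) \<subseteq> elts c" if "finite S" "S \<subseteq> \<D>" for S
    using that
  proof (induction S rule: finite_induct)
    case empty
    then show ?case
      using \<D>(2) by auto
  next
    case (insert x S)
    then obtain c where c: "c \<in> \<D>" "(\<Union>x\<in>S. elts x) \<subseteq> elts c"
      by auto
    obtain c'' where "c'' \<in> \<D>" "elts c \<union> elts x \<subseteq> elts c''"
      using dir[OF c(1), of x] insert.prems by auto
    then show ?case
      using c(2) by (intro bexI[of _ c'']) auto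
  qed
  \<comment> \<open>Specification for a recursion along proper inclusion of finite sets: the value
    at \<open>e\<close> lies above all values at proper subsets of \<open>e\<close>. Arguments that
    are not finite subsets of \<open>A\<close> are left unconstrained.\<close>
  define P where "P f e r \<longleftrightarrow> (finite e \<and> e \<subseteq> A \<longrightarrow>
      r \<in> \<D> \<and> e \<subseteq> elts r \<and> (\<forall>e'. e' \<subset> e \<longrightarrow> elts (f e') \<subseteq> elts r))" for f :: "'v set \<Rightarrow> 'v" and e r
  have "\<exists>F. \<forall>e. P F e (F e)"
  proof (rule dependent_wf_choice[OF wf_finite_psubset])
    fix f g :: "'v set \<Rightarrow> 'v" and e r
    assume "\<And>z. (z, e) \<in> finite_psubset \<Longrightarrow> f z = g z"
    then show "P f e r = P g e r"
      unfolding P_def finite_psubset_def by auto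
  next
    fix e and f :: "'v set \<Rightarrow> 'v"
    assume IH: "\<And>e'. (e', e) \<in> finite_psubset \<Longrightarrow> P f e' (f e')"
    show "\<exists>r. P f e r"
    proof (cases "finite e \<and> e \<subseteq> A")
      case True
      have "\<forall>x\<in>e. \<exists>c\<in>\<D>. x \<in> elts c"
        using True A(1) by blast
      then obtain g where g: "\<And>x. x \<in> e \<Longrightarrow> g x \<in> \<D> \<and> x \<in> elts (g x)"
        by metis
      have f: "f e' \<in> \<D>" if "e' \<subset> e" for e'
      proof -
        have "finite e'" "e' \<subseteq> A"
          using that True finite_subset by auto
        then show ?thesis
          using IH[of e'] that True by (auto simp: finite_psubset_def P_def)
      qed
      have "finite (g ` e \<union> f ` {e'. e' \<subset> e})"
        using True by (auto intro: finite_subset[of _ "Pow e"])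
      moreover have "g ` e \<union> f ` {e'. e' \<subset> e} \<subseteq> \<D>"
        using g f by auto
      ultimately obtain c where "c \<in> \<D>" "(\<Union>x\<in>g ` e \<union> f ` {e'. e' \<subset> e}. elts x) \<subseteq> elts c"
        by (metis bound)
      then have "P f e c"
        unfolding P_def using g by (auto simp: UN_subset_iff)
      then show ?thesis ..
    qed (auto simp: P_def)
  qed
  then obtain F where F: "\<And>e. P F e (F e)"
    by blast
  have F_mem: "F e \<in> \<D>" "e \<subseteq> elts (F e)" if "finite e" "e \<subseteq> A" for e
    using F[of e] that by (auto simp: P_def)
  have F_mono: "elts (F e') \<subseteq> elts (F e)" if "finite e" "e \<subseteq> A" "e' \<subseteq> e" for e e'
    using F[of e] that by (cases "e' = e") (auto simp: P_def)
  define G where "G B = (\<Union>e\<in>{e. finite e \<and> e \<subseteq> B}. elts (F e))" for B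
  have G_mono: "G B \<subseteq> G B'" if "B \<subseteq> B'" for B B'
    using that by (auto simp: G_def)
  have claim: "\<exists>Y\<in>C. elts Y = G (h ` elts \<gamma>)" if "\<gamma> \<in> elts \<kappa>" "h ` elts \<gamma> \<subseteq> A" for \<gamma> h
    using that
  proof (induction \<gamma> arbitrary: h rule: mem_induct)
    case (1 \<gamma>)
    have Ord: "Ord \<kappa>" "Ord \<gamma>"
      using Card 1(2) Ord_in_Ord by (auto simp: Card_def)
    have sub: "elts \<gamma> \<subseteq> elts \<kappa>"
      by (rule Ord_trans[OF Ord(1) 1(2)])
    \<comment> \<open>A finite image is settled by a single value of \<open>F\<close>. If
      \<open>\<gamma>\<close> is not a cardinal, composing \<open>h\<close> with a bijection leads
      to a smaller ordinal. If it is an infinite cardinal, the sets obtained for its elements form a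
      chain, to which the closure of the club applies.\<close>
    consider (fin) "finite (h ` elts \<gamma>)" | (smaller) \<alpha> where "\<alpha> \<in> elts \<gamma>" "elts \<alpha> \<approx> elts \<gamma>"
      | (card) "Card \<gamma>" "infinite (elts \<gamma>)"
      using Ord(2) by (auto simp: Card_def)
    then show ?case
    proof cases
      case fin
      have "G (h ` elts \<gamma>) = elts (F (h ` elts \<gamma>))"
        unfolding G_def using F_mono[OF fin 1(3)] fin by blast
      then show ?thesis
        using F_mem(1)[OF fin 1(3)] \<D>(1) by auto
    next
      case smaller
      then obtain g where "bij_betw g (elts \<alpha>) (elts \<gamma>)"
        by (auto simp: eqpoll_def)
      then have "(h \<circ> g) ` elts \<alpha> = h ` elts \<gamma>"
        unfolding bij_betw_def by (metis image_comp)
      then show ?thesis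
        using 1(1)[OF smaller(1), of "h \<circ> g"] smaller(1) sub 1(3) by auto
    next
      case card
      have limit: "\<exists>\<alpha>\<in>elts \<gamma>. \<xi> \<in> elts \<alpha>" if "\<xi> \<in> elts \<gamma>" for \<xi>
      proof (rule ccontr)
        assume "\<not> ?thesis"
        moreover have "\<alpha> \<in> elts \<xi> \<or> \<alpha> = \<xi> \<or> \<xi> \<in> elts \<alpha>" if "\<alpha> \<in> elts \<gamma>" for \<alpha>
          by (intro Ord_linear Ord_in_Ord[OF Ord(2)] that \<open>\<xi> \<in> elts \<gamma>\<close>)
        ultimately have "elts \<gamma> \<subseteq> insert \<xi> (elts \<xi>)"
          by blast
        moreover have "insert \<xi> (elts \<xi>) \<prec> elts \<gamma>"
          by (rule insert_lesspoll[OF card(2) Card_mem_lesspoll[OF card(1) that]])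
        ultimately show False
          using subset_lesspoll by blast
      qed
      \<comment> \<open>Since \<open>\<gamma>\<close> is a limit, finite subsets of the image are
        already covered at some stage below it; hence \<open>G\<close> is continuous along the
        chain.\<close>
      have cover: "\<exists>\<alpha>\<in>elts \<gamma>. e \<subseteq> h ` elts \<alpha>" if "finite e" "e \<subseteq> h ` elts \<gamma>" for e
        using that
      proof (induction e rule: finite_induct)
        case empty
        then show ?case
          using card(2) infinite_imp_nonempty by auto
      next
        case (insert x e)
        obtain \<alpha> where \<alpha>: "\<alpha> \<in> elts \<gamma>" "e \<subseteq> h ` elts \<alpha>"
          using insert by auto
        obtain \<xi> where "\<xi> \<in> elts \<gamma>" "x = h \<xi>"
          using insert by auto
        then obtain \<beta> where \<beta>: "\<beta> \<in> elts \<gamma>" "x \<in> h ` elts \<beta>"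
          using limit by blast
        have "elts \<alpha> \<subseteq> elts \<beta> \<or> elts \<beta> \<subseteq> elts \<alpha>"
          using Ord_linear[of \<alpha> \<beta>] Ord_trans[of \<alpha> \<beta>] Ord_trans[of \<beta> \<alpha>]
            Ord_in_Ord[OF Ord(2)] \<alpha>(1) \<beta>(1) by auto
        then show ?case
          using \<alpha> \<beta> by (meson image_mono insert_subset subset_trans subsetD)
      qed
      have "\<forall>\<alpha>\<in>elts \<gamma>. \<exists>Y\<in>C. elts Y = G (h ` elts \<alpha>)"
      proof
        fix \<alpha> assume \<alpha>: "\<alpha> \<in> elts \<gamma>"
        show "\<exists>Y\<in>C. elts Y = G (h ` elts \<alpha>)"
          using 1(1)[OF \<alpha>, of h] \<alpha> sub 1(3) Ord_trans[OF Ord(2) \<alpha>] by (meson image_mono subset_trans subsetD)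
      qed
      then obtain f where f: "\<And>\<alpha>. \<alpha> \<in> elts \<gamma> \<Longrightarrow> f \<alpha> \<in> C \<and> elts (f \<alpha>) = G (h ` elts \<alpha>)"
        by metis
      have mono: "elts (f \<alpha>) \<subseteq> elts (f \<beta>)" if "\<beta> \<in> elts \<gamma>" "\<alpha> \<in> elts \<beta>" for \<alpha> \<beta>
      proof -
        have "\<alpha> \<in> elts \<gamma>" "elts \<alpha> \<subseteq> elts \<beta>"
          using Ord_trans[OF Ord(2) that(1)] Ord_trans[OF Ord_in_Ord[OF Ord(2) that(1)] that(2)] that(2)
          by auto
        then show ?thesis
          using f that(1) G_mono[of "h ` elts \<alpha>" "h ` elts \<beta>"] by (simp add: image_mono)
      qed
      have "elts \<gamma> \<noteq> {}"
        using card(2) by auto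
      then have "coll (\<Union>\<alpha>\<in>elts \<gamma>. elts (f \<alpha>)) \<in> C"
        using club 1(2) f mono unfolding club_def by blast
      moreover have "G (h ` elts \<gamma>) = (\<Union>\<alpha>\<in>elts \<gamma>. G (h ` elts \<alpha>))"
      proof
        show "G (h ` elts \<gamma>) \<subseteq> (\<Union>\<alpha>\<in>elts \<gamma>. G (h ` elts \<alpha>))"
        proof
          fix x assume "x \<in> G (h ` elts \<gamma>)"
          then obtain e where e: "finite e" "e \<subseteq> h ` elts \<gamma>" "x \<in> elts (F e)"
            by (auto simp: G_def)
          then obtain \<alpha> where "\<alpha> \<in> elts \<gamma>" "e \<subseteq> h ` elts \<alpha>"
            using cover by metis
          then show "x \<in> (\<Union>\<alpha>\<in>elts \<gamma>. G (h ` elts \<alpha>))"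
            using e by (auto simp: G_def)
        qed
        show "(\<Union>\<alpha>\<in>elts \<gamma>. G (h ` elts \<alpha>)) \<subseteq> G (h ` elts \<gamma>)"
          using G_mono Ord_trans[OF Ord(2)] by (meson UN_least image_mono)
      qed
      moreover have "(\<Union>\<alpha>\<in>elts \<gamma>. elts (f \<alpha>)) = (\<Union>\<alpha>\<in>elts \<gamma>. G (h ` elts \<alpha>))"
        by (rule SUP_cong) (use f in auto)
      moreover have "elts (coll (\<Union>\<alpha>\<in>elts \<gamma>. elts (f \<alpha>))) = (\<Union>\<alpha>\<in>elts \<gamma>. elts (f \<alpha>))"
        by (intro elts_coll small_UN small_elts)
      ultimately show ?thesis
        by metis
    qed
  qed
  obtain \<gamma> where \<gamma>: "\<gamma> \<in> elts \<kappa>" "A \<approx> elts \<gamma>"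
    using lesspoll_Ord_eqpoll[OF _ A(2)] Card by (auto simp: Card_def)
  then obtain h where "h ` elts \<gamma> = A"
    by (meson bij_betw_def eqpoll_def eqpoll_sym)
  then obtain Y where Y: "Y \<in> C" "elts Y = G A"
    using claim[OF \<gamma>(1), of h] by auto
  have "A \<subseteq> G A"
  proof
    fix a assume "a \<in> A"
    then have "a \<in> elts (F {a})" "finite {a}" "{a} \<subseteq> A"
      using F_mem(2)[of "{a}"] by auto
    then show "a \<in> G A"
      unfolding G_def by blast
  qed
  moreover have "G A \<subseteq> (\<Union>c\<in>\<D>. elts c)"
    unfolding G_def using F_mem(1) by blast
  ultimately show thesis
    using that Y by simp
qed


section \<open>Sets of hereditarily small cardinality\<close>

lemma mem_trans_closure: "y \<in> elts x \<Longrightarrow> y \<in> trans_closure x"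
  by (auto simp: trans_closure_def)

lemma trans_closure_mono: "y \<in> trans_closure x \<Longrightarrow> trans_closure y \<subseteq> trans_closure x"
  by (auto simp: trans_closure_def intro: trancl_trans)

lemma trans_closure_unfold: "trans_closure x = elts x \<union> (\<Union>y\<in>elts x. trans_closure y)"
proof
  show "trans_closure x \<subseteq> elts x \<union> (\<Union>y\<in>elts x. trans_closure y)"
    unfolding trans_closure_def by (auto elim: tranclE)
  show "elts x \<union> (\<Union>y\<in>elts x. trans_closure y) \<subseteq> trans_closure x"
    using mem_trans_closure trans_closure_mono by blast
qed

lemma small_trans_closure: "small (trans_closure x)"
proof (induction x rule: mem_induct)
  case (1 x)
  then show ?case
    unfolding trans_closure_unfold[of x] by (intro small_Un small_UN) auto
qed

lemma H_trans: "x \<in> H \<theta> \<Longrightarrow> y \<in> elts x \<Longrightarrow> y \<in> H \<theta>"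
  unfolding H_def using trans_closure_mono[OF mem_trans_closure] subset_lesspoll by blast

lemma trans_class_H: "trans_class (H \<theta>)"
  unfolding trans_class_def using H_trans by blast

lemma H_subset:
  assumes "x \<in> H \<theta>" "elts y \<subseteq> elts x"
  shows "y \<in> H \<theta>"
proof -
  have "trans_closure y \<subseteq> trans_closure x"
    using assms(2) unfolding trans_closure_unfold[of y] trans_closure_unfold[of x] by blast
  then show ?thesis
    using assms(1) subset_lesspoll by (auto simp: H_def)
qed

lemma H_empty:
  fixes \<theta> :: "'v::zfc"
  shows "infinite (elts \<theta>) \<Longrightarrow> coll {} \<in> H \<theta>"
  using trans_closure_unfold[of "coll {} :: 'v"] by (simp add: H_def finite_lesspoll_infinite)

lemma H_upair:
  assumes "infinite (elts \<theta>)" "a \<in> H \<theta>" "b \<in> H \<theta>"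
  shows "coll {a, b} \<in> H \<theta>"
proof -
  have "{a, b} \<union> (trans_closure a \<union> trans_closure b) \<prec> elts \<theta>"
    using assms by (intro Un_lesspoll) (auto simp: H_def finite_lesspoll_infinite)
  moreover have "trans_closure (coll {a, b}) = {a, b} \<union> (trans_closure a \<union> trans_closure b)"
    unfolding trans_closure_unfold[of "coll {a, b}"] by simp
  ultimately show ?thesis
    by (simp add: H_def)
qed


section \<open>Elementary embeddings into H(\<theta>)\<close>

definition Exists :: "nat \<Rightarrow> fm \<Rightarrow> fm" where
  "Exists n \<phi> = Neg (Forall n (Neg \<phi>))"

lemma sat_Exists [simp]: "sat A (Exists n \<phi>) s \<longleftrightarrow> (\<exists>x\<in>A. sat A \<phi> (s(n := x)))"
  by (simp add: Exists_def)

text \<open>The variables from 9 on are reserved for quantification.\<close>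

definition upair_fm :: "nat \<Rightarrow> nat \<Rightarrow> nat \<Rightarrow> fm" where
  "upair_fm u a b = And (Mem a u) (And (Mem b u)
     (Forall 9 (Neg (And (Mem 9 u) (And (Neg (Eq 9 a)) (Neg (Eq 9 b)))))))"

definition opair_fm :: "nat \<Rightarrow> nat \<Rightarrow> nat \<Rightarrow> fm" where
  "opair_fm p a b =
     Exists 10 (Exists 11 (And (upair_fm 10 a a) (And (upair_fm 11 a b) (upair_fm p 10 11))))"

text \<open>Transitivity of \<open>A\<close> makes the formula absolute, since its quantifier then
  reaches every element of \<open>s u\<close>.\<close>

lemma sat_upair_fm [simp]:
  assumes "trans_class A" "s u \<in> A" "u \<noteq> 9" "a \<noteq> 9" "b \<noteq> 9"
  shows "sat A (upair_fm u a b) s \<longleftrightarrow> s u = coll {s a, s b}"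
proof -
  have "sat A (upair_fm u a b) s \<longleftrightarrow> elts (s u) = {s a, s b}"
    using assms by (auto simp: upair_fm_def trans_class_def)
  also have "\<dots> \<longleftrightarrow> s u = coll {s a, s b}"
    by (metis coll_elts elts_coll small_doubleton)
  finally show ?thesis .
qed

lemma sat_opair_fm [simp]:
  assumes "trans_class A" "s p \<in> A" "p < 9" "a < 9" "b < 9"
  shows "sat A (opair_fm p a b) s \<longleftrightarrow> s p = opair (s a) (s b)"
proof -
  have "coll {s a} \<in> A \<and> coll {s a, s b} \<in> A" if "s p = opair (s a) (s b)"
    using assms(1,2) that unfolding trans_class_def by (metis elts_opair insert_subset)
  then show ?thesis
    using assms by (auto simp: opair_fm_def opair_def)
qed

locale embedding =
  fixes \<theta> :: "'v::zfc" and M :: "'v set" and j :: "'v \<Rightarrow> 'v"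
  assumes infinite_\<theta>: "infinite (elts \<theta>)"
    and trans_M: "trans_class M"
    and elem: "elementary M (H \<theta>) j"
begin

lemma j_in_H: "x \<in> M \<Longrightarrow> j x \<in> H \<theta>"
  using elem by (auto simp: elementary_def)

lemma elem_sat: "range s \<subseteq> M \<Longrightarrow> sat M \<phi> s \<longleftrightarrow> sat (H \<theta>) \<phi> (j \<circ> s)"
  using elem by (auto simp: elementary_def)

lemma M_trans: "x \<in> M \<Longrightarrow> y \<in> elts x \<Longrightarrow> y \<in> M"
  using trans_M by (auto simp: trans_class_def)

lemma j_mem_iff [simp]: "x \<in> M \<Longrightarrow> y \<in> M \<Longrightarrow> j x \<in> elts (j y) \<longleftrightarrow> x \<in> elts y"
  using elem_sat[of "(\<lambda>_. y)(0 := x)" "Mem 0 1"] by auto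

lemma j_eq_iff [simp]: "x \<in> M \<Longrightarrow> y \<in> M \<Longrightarrow> j x = j y \<longleftrightarrow> x = y"
  using elem_sat[of "(\<lambda>_. y)(0 := x)" "Eq 0 1"] by auto

lemma j_subset:
  assumes "x \<in> M" "y \<in> M" "elts x \<subseteq> elts y"
  shows "elts (j x) \<subseteq> elts (j y)"
proof -
  let ?\<phi> = "Forall 2 (Neg (And (Mem 2 0) (Neg (Mem 2 1))))"
  have "sat M ?\<phi> ((\<lambda>_. y)(0 := x))" "range ((\<lambda>_. y)(0 := x)) \<subseteq> M"
    using assms by auto
  then have "sat (H \<theta>) ?\<phi> (j \<circ> (\<lambda>_. y)(0 := x))"
    using elem_sat by blast
  then show ?thesis
    using H_trans[OF j_in_H[OF assms(1)]] by auto
qed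

text \<open>The Tarski-Vaught property of the range: an existential statement with parameters in the
  range reflects to \<open>M\<close>, and the witness found there is sent to one in the
  range.\<close>

lemma elem_witness:
  assumes "range s \<subseteq> M" "y \<in> H \<theta>" "sat (H \<theta>) \<phi> ((j \<circ> s)(n := y))"
  obtains x where "x \<in> M" "sat (H \<theta>) \<phi> ((j \<circ> s)(n := j x))"
proof -
  have "sat (H \<theta>) (Exists n \<phi>) (j \<circ> s)"
    using assms by auto
  then have "sat M (Exists n \<phi>) s"
    using elem_sat assms(1) by blast
  then obtain x where x: "x \<in> M" "sat M \<phi> (s(n := x))"
    by auto
  have "range (s(n := x)) \<subseteq> M"
    using assms(1) x(1) by auto
  then have "sat (H \<theta>) \<phi> (j \<circ> s(n := x))"
    using elem_sat x(2) by blast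
  moreover have "j \<circ> s(n := x) = (j \<circ> s)(n := j x)"
    by auto
  ultimately show thesis
    using that x(1) by simp
qed

lemma elts_j_eqD:
  assumes "u \<in> M" "elts (j u) = j ` A" "A \<subseteq> M"
  shows "elts u = A"
proof -
  have "x \<in> elts u \<longleftrightarrow> x \<in> A" if "x \<in> M" for x
    using assms that j_mem_iff[OF that assms(1)] by (auto simp: subset_iff)
  then show ?thesis
    using assms(1,3) M_trans by blast
qed

lemma j_upair:
  assumes "a \<in> M" "b \<in> M"
  shows "coll {a, b} \<in> M" "j (coll {a, b}) = coll {j a, j b}"
proof -
  have "coll {j a, j b} \<in> H \<theta>"
    by (intro H_upair infinite_\<theta> j_in_H assms)
  then obtain u where u: "u \<in> M" "j u = coll {j a, j b}"
    using elem_witness[of "(\<lambda>_. b)(1 := a)" "coll {j a, j b}" "upair_fm 0 1 2" 0] assms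
    by (auto simp: trans_class_H j_in_H)
  then have "elts u = {a, b}"
    using elts_j_eqD[of u "{a, b}"] assms by simp
  then have "u = coll {a, b}"
    using coll_elts[of u] by simp
  then show "coll {a, b} \<in> M" "j (coll {a, b}) = coll {j a, j b}"
    using u by simp_all
qed

lemma j_opair:
  assumes "a \<in> M" "b \<in> M"
  shows "opair a b \<in> M" "j (opair a b) = opair (j a) (j b)"
  using j_upair[of a a] j_upair[of a b] assms j_upair[of "coll {a}" "coll {a, b}"]
  by (simp_all add: opair_def)

lemma j_empty:
  assumes "M \<noteq> {}"
  shows "coll {} \<in> M" "j (coll {}) = coll {}"
proof -
  obtain a where "a \<in> M"
    using assms by blast
  then obtain u where u: "u \<in> M" "sat (H \<theta>) (Forall 1 (Neg (Mem 1 0))) ((j \<circ> (\<lambda>_. a))(0 := j u))"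
    using elem_witness[of "\<lambda>_. a" "coll {}" "Forall 1 (Neg (Mem 1 0))" 0] H_empty[OF infinite_\<theta>]
    by auto
  then have "elts (j u) = {}"
    using H_trans[OF j_in_H] by auto
  then have "j u = coll {}" "elts u = {}"
    using coll_elts[of "j u"] elts_j_eqD[of u "{}"] u(1) by simp_all
  moreover from this have "u = coll {}"
    using coll_elts[of u] by simp
  ultimately show "coll {} \<in> M" "j (coll {}) = coll {}"
    using u(1) by simp_all
qed

lemma j_apply:
  assumes "a \<in> M" "g \<in> M" "opair (j a) y \<in> elts (j g)"
  obtains x where "x \<in> M" "opair (j a) (j x) \<in> elts (j g)"
proof -
  \<comment> \<open>Variable 0 is the value, 1 the argument and 3 the pair; variable 2 gets the
    default of the assignment, which is the function.\<close>
  let ?\<phi> = "Exists 3 (And (Mem 3 2) (opair_fm 3 1 0))"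
  have p: "opair (j a) y \<in> H \<theta>"
    using H_trans[OF j_in_H] assms by blast
  have "coll {j a, y} \<in> H \<theta>"
    using H_trans[OF p] by (simp add: elts_opair)
  then have "y \<in> H \<theta>"
    using H_trans[of "coll {j a, y}"] by simp
  moreover have "sat (H \<theta>) ?\<phi> ((j \<circ> (\<lambda>_. g)(1 := a))(0 := y))"
    using assms p by (auto simp: trans_class_H intro!: bexI[of _ "opair (j a) y"])
  moreover have "range ((\<lambda>_. g)(1 := a)) \<subseteq> M"
    using assms by auto
  ultimately obtain x where "x \<in> M" "sat (H \<theta>) ?\<phi> ((j \<circ> (\<lambda>_. g)(1 := a))(0 := j x))"
    using elem_witness by blast
  then show thesis
    using that by (auto simp: trans_class_H)
qed

text \<open>A function in the range, applied to an argument in the range, has some value in the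
  range by elementarity, and values are unique. All closure properties of the hulls below rest on
  this.\<close>

lemma graph_apply_in_image:
  assumes "small A" "graph A f \<in> j ` M" "a \<in> j ` M" "a \<in> A"
  shows "f a \<in> j ` M"
proof -
  obtain g b where "g \<in> M" "j g = graph A f" "b \<in> M" "j b = a"
    using assms(2,3) by auto
  moreover from this have "opair (j b) (f a) \<in> elts (j g)"
    using assms(1,4) by simp
  ultimately obtain x where "x \<in> M" "opair (j b) (j x) \<in> elts (graph A f)"
    using j_apply by metis
  then have "x \<in> M" "j x = f a"
    using assms(1) \<open>j b = a\<close> by auto
  then show ?thesis
    by (metis image_eqI)
qed

lemma opair_in_image: "a \<in> j ` M \<Longrightarrow> b \<in> j ` M \<Longrightarrow> opair a b \<in> j ` M"
  using j_opair by (metis (no_types, lifting) imageE image_eqI)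

end

locale small_embed =
  fixes \<kappa> \<theta> M :: "'v::zfc" and j
  assumes small_emb: "small_embedding \<kappa> \<theta> M j" and inf_\<theta>: "infinite (elts \<theta>)"

sublocale small_embed \<subseteq> embedding \<theta> "elts M" j
  using small_emb inf_\<theta> by unfold_locales (auto simp: small_embedding_def)

context small_embed
begin

lemma Card_\<kappa>: "Card \<kappa>"
  using small_emb by (simp add: small_embedding_def)

text \<open>\<open>\<kappa>'\<close> is the critical point. As
  \<open>j \<kappa>' = \<kappa>\<close>, a value \<open>j x\<close> is below \<open>\<kappa>\<close>
  exactly if \<open>x\<close> is below \<open>\<kappa>'\<close>, and there \<open>j\<close> is the
  identity.\<close>

lemma image_Int_\<kappa>:
  obtains \<kappa>' where "\<kappa>' \<in> elts \<kappa>" "j ` elts M \<inter> elts \<kappa> = elts \<kappa>'"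
    "\<And>\<gamma>. \<gamma> \<in> elts \<kappa>' \<Longrightarrow> \<gamma> \<in> elts M \<and> j \<gamma> = \<gamma>"
proof -
  define moved where "moved \<alpha> \<longleftrightarrow> \<alpha> \<in> elts M \<and> Ord \<alpha> \<and> \<alpha> \<in> elts (j \<alpha>)" for \<alpha>
  obtain \<alpha> where "moved \<alpha>" "Ord \<alpha>"
    using small_emb by (auto simp: small_embedding_def nontrivial_def moved_def)
  then obtain \<kappa>' where \<kappa>': "moved \<kappa>'" "Ord \<kappa>'"
    and least: "\<And>\<gamma>. moved \<gamma> \<Longrightarrow> Ord \<gamma> \<Longrightarrow> \<kappa>' = \<gamma> \<or> \<kappa>' \<in> elts \<gamma>"
    using Ord_least[of moved] by metis
  have "crit (elts M) j = \<kappa>'"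
    unfolding crit_def
  proof (rule the_equality)
    show "\<kappa>' \<in> elts M \<and> Ord \<kappa>' \<and> \<kappa>' \<in> elts (j \<kappa>') \<and>
        (\<forall>\<beta>\<in>elts M. Ord \<beta> \<and> \<beta> \<in> elts (j \<beta>) \<longrightarrow> \<beta> = \<kappa>' \<or> \<kappa>' \<in> elts \<beta>)"
      using \<kappa>' least by (auto simp: moved_def)
  next
    fix \<alpha>
    assume "\<alpha> \<in> elts M \<and> Ord \<alpha> \<and> \<alpha> \<in> elts (j \<alpha>) \<and>
        (\<forall>\<beta>\<in>elts M. Ord \<beta> \<and> \<beta> \<in> elts (j \<beta>) \<longrightarrow> \<beta> = \<alpha> \<or> \<alpha> \<in> elts \<beta>)"
    then show "\<alpha> = \<kappa>'"
      using \<kappa>' least[of \<alpha>] mem_not_sym[of \<alpha> \<kappa>'] by (auto simp: moved_def)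
  qed
  then have j\<kappa>': "j \<kappa>' = \<kappa>"
    using small_emb by (simp add: small_embedding_def)
  have \<kappa>'M: "\<kappa>' \<in> elts M" and \<kappa>'\<kappa>: "\<kappa>' \<in> elts \<kappa>"
    using \<kappa>' j\<kappa>' by (auto simp: moved_def)
  have Ord_\<kappa>: "Ord \<kappa>"
    using Card_\<kappa> by (simp add: Card_def)
  \<comment> \<open>If \<open>j\<close> fixes all elements of \<open>\<gamma>\<close>, then
    \<open>\<gamma>\<close> is included in \<open>j \<gamma>\<close>; the inclusion is not proper,
    because \<open>\<gamma>\<close> lies below the least ordinal that is moved up.\<close>
  have fixed: "j \<gamma> = \<gamma>" if "\<gamma> \<in> elts \<kappa>'" for \<gamma>
    using that
  proof (induction \<gamma> rule: mem_induct)
    case (1 \<gamma>)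
    have \<gamma>: "\<gamma> \<in> elts M" "Ord \<gamma>"
      using M_trans[OF \<kappa>'M] Ord_in_Ord[OF \<kappa>'(2)] 1(2) by auto
    have "j \<gamma> \<in> elts \<kappa>"
      using j_mem_iff[OF \<gamma>(1) \<kappa>'M] 1(2) j\<kappa>' by simp
    then have Ordj: "Ord (j \<gamma>)"
      by (rule Ord_in_Ord[OF Ord_\<kappa>])
    have "elts \<gamma> \<subseteq> elts (j \<gamma>)"
    proof
      fix \<beta> assume \<beta>: "\<beta> \<in> elts \<gamma>"
      then have "j \<beta> = \<beta>"
        using 1 Ord_trans[OF \<kappa>'(2)] by blast
      moreover have "j \<beta> \<in> elts (j \<gamma>)"
        using j_mem_iff[OF M_trans[OF \<gamma>(1) \<beta>] \<gamma>(1)] \<beta> by simp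
      ultimately show "\<beta> \<in> elts (j \<gamma>)"
        by simp
    qed
    then have "\<gamma> \<in> elts (j \<gamma>) \<or> \<gamma> = j \<gamma>"
      using Ord_subset_iff[OF \<gamma>(2) Ordj] by simp
    moreover have "\<gamma> \<notin> elts (j \<gamma>)"
      using least[of \<gamma>] \<gamma> 1(2) mem_not_sym[of \<gamma> \<kappa>'] by (auto simp: moved_def)
    ultimately show ?case
      by simp
  qed
  have "j ` elts M \<inter> elts \<kappa> = elts \<kappa>'"
  proof (intro equalityI subsetI)
    fix y assume "y \<in> j ` elts M \<inter> elts \<kappa>"
    then obtain x where x: "x \<in> elts M" "y = j x" "j x \<in> elts (j \<kappa>')"
      using j\<kappa>' by auto
    then have "x \<in> elts \<kappa>'"
      using \<kappa>'M by simp
    then show "y \<in> elts \<kappa>'"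
      using fixed x by simp
  next
    fix y assume y: "y \<in> elts \<kappa>'"
    then have "y = j y" "y \<in> elts M"
      using fixed M_trans[OF \<kappa>'M] by auto
    then show "y \<in> j ` elts M \<inter> elts \<kappa>"
      using y Ord_trans[OF Ord_\<kappa> \<kappa>'\<kappa>] by blast
  qed
  then show thesis
    using that[OF \<kappa>'\<kappa>] fixed M_trans[OF \<kappa>'M] by blast
qed

text \<open>The range meets \<open>\<kappa>\<close> in an ordinal, hence in a transitive
  set.\<close>

lemma image_mem_\<kappa>_subset:
  assumes "\<gamma> \<in> j ` elts M" "\<gamma> \<in> elts \<kappa>"
  shows "elts \<gamma> \<subseteq> j ` elts M"
proof -
  obtain \<kappa>' where \<kappa>': "\<kappa>' \<in> elts \<kappa>" "j ` elts M \<inter> elts \<kappa> = elts \<kappa>'"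
    by (rule image_Int_\<kappa>)
  have "Ord \<kappa>'"
    using Card_\<kappa> \<kappa>'(1) Ord_in_Ord by (auto simp: Card_def)
  then have "elts \<gamma> \<subseteq> elts \<kappa>'"
    by (rule Ord_trans) (use assms \<kappa>' in blast)
  then show ?thesis
    using \<kappa>'(2) by blast
qed

lemma fixed_below_\<kappa>:
  assumes "\<gamma> \<in> j ` elts M" "\<gamma> \<in> elts \<kappa>"
  shows "\<gamma> \<in> elts M" "j \<gamma> = \<gamma>"
  using image_Int_\<kappa> assms by (metis IntI)+

lemma M_nonempty: "elts M \<noteq> {}"
  using small_emb by (auto simp: small_embedding_def nontrivial_def)

end


section \<open>Hulls inside the range of the embedding\<close>

text \<open>Stand-ins for the HOL naturals. They are built from the empty set by pairing alone,
  which puts them into the range of every embedding considered here.\<close>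

primrec tag :: "nat \<Rightarrow> 'v::zfc" where
  "tag 0 = coll {}"
| "tag (Suc n) = opair (coll {}) (tag n)"

lemma inj_tag: "inj (tag :: nat \<Rightarrow> 'v::zfc)"
proof (rule injI)
  have ne: "opair a b \<noteq> coll {}" "coll {} \<noteq> opair a b" for a b :: 'v
    using elts_opair[of a b] by (metis elts_coll insert_not_empty small_empty)+
  fix m n
  show "(tag m :: 'v) = tag n \<Longrightarrow> m = n"
  proof (induction m arbitrary: n)
    case 0
    then show ?case
      using ne by (cases n) auto
  next
    case (Suc m)
    then show ?case
      using ne by (cases n) auto
  qed
qed

text \<open>
  The functions \<open>fs\<close> are restricted to a set that is closed under them and coded, indexed by
  the values of \<open>tag\<close>, into the set \<open>x\<close> that the definition puts into the range.
\<close>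

lemma ineffable_hull:
  fixes \<kappa> \<mu> :: "'v::zfc"
  assumes ineffable: "internally_AP_ineffable \<kappa> \<mu>" and d: "Pk_list \<kappa> \<mu> d" and "small A"
  obtains \<theta> j M \<delta> N R where
    "small_embed \<kappa> \<theta> M j" "\<delta> \<in> elts M" "\<delta> \<in> elts \<kappa>" "j \<delta> = \<mu>"
    "trans_class N" "ZFC_minus_model N" "omega1_approximation N (H \<theta>)" "M \<in> N" "M \<in> H \<theta>"
    "\<And>b. b \<in> N \<Longrightarrow> elts b \<subseteq> elts \<delta> \<Longrightarrow> countable_in N b \<Longrightarrow> b \<in> elts M"
    "coll {\<xi> \<in> elts M. j \<xi> \<in> elts (d (coll (j ` elts \<delta>)))} \<in> N \<Longrightarrow>
      coll {\<xi> \<in> elts M. j \<xi> \<in> elts (d (coll (j ` elts \<delta>)))} \<in> elts M"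
    "R \<subseteq> j ` elts M" "A \<inter> j ` elts M \<subseteq> R" "coll {} \<in> R"
    "\<And>a b. a \<in> R \<Longrightarrow> b \<in> R \<Longrightarrow> opair a b \<in> R"
    "\<And>f a. f \<in> set fs \<Longrightarrow> a \<in> R \<Longrightarrow> f a \<in> R"
proof -
  obtain U :: 'v where U: "insert (coll {}) A \<subseteq> elts U"
      "\<And>f a. f \<in> set fs \<Longrightarrow> a \<in> elts U \<Longrightarrow> f a \<in> elts U"
      "\<And>a b. a \<in> elts U \<Longrightarrow> b \<in> elts U \<Longrightarrow> opair a b \<in> elts U"
    using small_closure[of "insert (coll {}) A" fs] assms(3) by auto
  define T :: "'v set" where "T = range tag"
  have "small T"
    unfolding T_def by (rule small_range_nat)
  define x where "x = graph T (\<lambda>t. graph (elts U) (fs ! inv tag t))"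
  obtain \<alpha> where \<alpha>: "Ord \<alpha>" and emb: "\<forall>\<theta>. regular \<theta> \<and> \<alpha> \<in> elts \<theta> \<longrightarrow> (\<forall>x\<in>H \<theta>. \<forall>d. Pk_list \<kappa> \<mu> d \<longrightarrow>
           (\<exists>j M \<delta> N.
              small_embedding \<kappa> \<theta> M j \<and>
              Ord \<delta> \<and> \<delta> \<in> elts M \<and>
              trans_class N \<and> ZFC_minus_model N \<and>
              j \<delta> = \<mu> \<and>
              x \<in> j ` elts M \<and> graph (Pk \<kappa> (elts \<mu>)) d \<in> j ` elts M \<and>
              \<delta> \<in> elts \<kappa> \<and>
              N \<subseteq> H \<theta> \<and> omega1_approximation N (H \<theta>) \<and>
              M \<in> N \<and> {b \<in> N. elts b \<subseteq> elts \<delta> \<and> countable_in N b} \<subseteq> elts M \<and>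
              (let e = coll {\<xi> \<in> elts M. j \<xi> \<in> elts (d (coll (j ` elts \<delta>)))}
               in e \<in> N \<longrightarrow> e \<in> elts M)))"
    using ineffable unfolding internally_AP_ineffable_def by (elim exE conjE) (rule that)
  \<comment> \<open>\<open>\<theta>\<close> has to exceed the size of the transitive closure of
    \<open>x\<close>, so that \<open>x\<close> is in \<open>H \<theta>\<close>, and the bound
    \<open>\<alpha>\<close> from ineffability.\<close>
  have "small (trans_closure x \<union> elts \<alpha>)"
    by (intro small_Un small_trans_closure small_elts)
  then obtain \<theta> :: 'v where \<theta>: "regular \<theta>" "trans_closure x \<union> elts \<alpha> \<prec> elts \<theta>"
      "\<And>\<beta>. Ord \<beta> \<Longrightarrow> elts \<beta> \<subseteq> trans_closure x \<union> elts \<alpha> \<Longrightarrow> \<beta> \<in> elts \<theta>"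
    by (rule regular_exists) (rule that, assumption+)
  have "x \<in> H \<theta>"
    unfolding H_def using subset_lesspoll[OF Un_upper1 \<theta>(2)] by simp
  moreover have "\<alpha> \<in> elts \<theta>"
    using \<theta>(3) \<alpha> by blast
  ultimately have ex: "regular \<theta> \<and> \<alpha> \<in> elts \<theta>" "x \<in> H \<theta>"
    using \<theta>(1) by simp_all
  obtain j M \<delta> N where
    *: "small_embedding \<kappa> \<theta> M j" "\<delta> \<in> elts M" "\<delta> \<in> elts \<kappa>" "j \<delta> = \<mu>"
      "trans_class N" "ZFC_minus_model N" "omega1_approximation N (H \<theta>)" "M \<in> N"
      "{b \<in> N. elts b \<subseteq> elts \<delta> \<and> countable_in N b} \<subseteq> elts M"
      "coll {\<xi> \<in> elts M. j \<xi> \<in> elts (d (coll (j ` elts \<delta>)))} \<in> N \<longrightarrow>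
        coll {\<xi> \<in> elts M. j \<xi> \<in> elts (d (coll (j ` elts \<delta>)))} \<in> elts M"
    and x: "x \<in> j ` elts M"
    using emb[THEN spec, THEN mp, OF ex(1), THEN bspec, OF ex(2), THEN spec, THEN mp, OF d]
    unfolding Let_def by (elim exE conjE) (rule that)
  have "infinite (elts \<theta>)"
    using \<theta>(1) by (simp add: regular_def)
  then interpret small_embed \<kappa> \<theta> M j
    using *(1) by unfold_locales
  have zero: "coll {} \<in> j ` elts M"
    using j_empty[OF M_nonempty] by (metis image_eqI)
  have tag: "tag n \<in> j ` elts M" for n
    by (induction n) (simp_all add: zero opair_in_image)
  \<comment> \<open>Only the restrictions of the functions to \<open>U\<close> are known to be in
    the range, so closure is claimed for the part of the range inside \<open>U\<close>.\<close>
  define R where "R = elts U \<inter> j ` elts M"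
  have app: "f a \<in> R" if fa: "f \<in> set fs" "a \<in> R" for f a
  proof -
    obtain n where n: "fs ! n = f"
      using fa(1) by (auto simp: in_set_conv_nth)
    have "graph (elts U) (fs ! inv tag (tag n :: 'v)) \<in> j ` elts M"
      by (rule graph_apply_in_image[OF \<open>small T\<close> x[unfolded x_def] tag]) (simp add: T_def)
    then have "graph (elts U) f \<in> j ` elts M"
      by (simp add: inv_f_f[OF inj_tag] n)
    then have "f a \<in> j ` elts M"
      using graph_apply_in_image[of "elts U" f a] fa(2) by (simp add: R_def)
    then show ?thesis
      using U(2) fa by (simp add: R_def)
  qed
  have pair: "opair a b \<in> R" if "a \<in> R" "b \<in> R" for a b
    using that U(3) opair_in_image by (simp add: R_def)
  have "M \<in> H \<theta>"
    using *(1) by (simp add: small_embedding_def)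
  have b: "b \<in> elts M" if "b \<in> N" "elts b \<subseteq> elts \<delta>" "countable_in N b" for b
    using *(9) that by blast
  have R: "R \<subseteq> j ` elts M" "A \<inter> j ` elts M \<subseteq> R" "coll {} \<in> R"
    using U(1) zero by (auto simp: R_def)
  show thesis
    by (rule that[OF small_embed_axioms *(2-8) \<open>M \<in> H \<theta>\<close>])
      (fact b mp[OF *(10)] R pair app)+
qed

lemma ineffable_Card:
  assumes "internally_AP_ineffable \<kappa> \<mu>"
  shows "Card \<kappa>"
proof -
  have "Pk_list \<kappa> \<mu> (\<lambda>a. a)"
    by (simp add: Pk_list_def)
  then obtain \<theta> M j where "small_embed \<kappa> \<theta> M j"
    by (rule ineffable_hull[OF assms _ small_empty]) (rule that)
  then show ?thesis
    by (rule small_embed.Card_\<kappa>)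
qed

text \<open>An enumeration of a countable \<open>\<kappa>\<close>, indexed by the values of
  \<open>tag\<close>, would put all of \<open>\<kappa>\<close> into the range. But the range meets
  \<open>\<kappa>\<close> in an element of \<open>\<kappa>\<close>, which it therefore
  omits.\<close>

lemma ineffable_uncountable:
  fixes \<kappa> \<mu> :: "'v::zfc"
  assumes "internally_AP_ineffable \<kappa> \<mu>"
  shows "uncountable (elts \<kappa>)"
proof
  assume count: "countable (elts \<kappa>)"
  have "Pk_list \<kappa> \<mu> (\<lambda>a. a)"
    by (simp add: Pk_list_def)
  then obtain \<theta> j M and R :: "'v set" where "small_embed \<kappa> \<theta> M j" and R: "R \<subseteq> j ` elts M" "coll {} \<in> R"
      "\<And>a b. a \<in> R \<Longrightarrow> b \<in> R \<Longrightarrow> opair a b \<in> R"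
      "\<And>f a. f \<in> set [\<lambda>t. from_nat_into (elts \<kappa>) (inv tag t)] \<Longrightarrow> a \<in> R \<Longrightarrow> f a \<in> R"
    by (rule ineffable_hull[OF assms _ small_empty]) (rule that, assumption+)
  interpret small_embed \<kappa> \<theta> M j
    by fact
  obtain \<kappa>' where \<kappa>': "\<kappa>' \<in> elts \<kappa>" "j ` elts M \<inter> elts \<kappa> = elts \<kappa>'"
    by (rule image_Int_\<kappa>)
  have tag: "tag n \<in> R" for n
    by (induction n) (simp_all add: R)
  have "\<kappa>' = from_nat_into (elts \<kappa>) (to_nat_on (elts \<kappa>) \<kappa>')"
    using count \<kappa>'(1) by simp
  then have "\<kappa>' \<in> R"
    using R(4)[OF _ tag[of "to_nat_on (elts \<kappa>) \<kappa>'"]] by (simp add: inv_f_f[OF inj_tag])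
  then show False
    using \<kappa>' R(1) mem_not_refl[of \<kappa>'] by blast
qed

text \<open>Let \<open>q\<close> enumerate \<open>X\<close> along some \<open>\<gamma>\<close> below
  \<open>\<kappa>\<close>, with both in the hull. Then \<open>\<gamma>\<close> is included in the
  range, hence so is \<open>X\<close>, and the critical point bounds \<open>X\<close>.\<close>

lemma ineffable_regular:
  fixes \<kappa> \<mu> :: "'v::zfc"
  assumes "internally_AP_ineffable \<kappa> \<mu>"
  shows "regular \<kappa>"
  unfolding regular_def
proof (intro conjI allI impI)
  show "Card \<kappa>"
    using ineffable_Card[OF assms] .
  show "infinite (elts \<kappa>)"
    using ineffable_uncountable[OF assms] countable_finite by blast
  fix X assume X: "X \<subseteq> elts \<kappa> \<and> X \<prec> elts \<kappa>"
  then obtain \<gamma> where \<gamma>: "\<gamma> \<in> elts \<kappa>" "X \<approx> elts \<gamma>"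
    using lesspoll_Ord_eqpoll \<open>Card \<kappa>\<close> unfolding Card_def by blast
  then obtain q where q: "q ` elts \<gamma> = X"
    by (meson bij_betw_def eqpoll_def eqpoll_sym)
  have "Pk_list \<kappa> \<mu> (\<lambda>a. a)"
    by (simp add: Pk_list_def)
  then obtain \<theta> j M and R :: "'v set" where "small_embed \<kappa> \<theta> M j"
    and R: "R \<subseteq> j ` elts M" "elts \<kappa> \<inter> j ` elts M \<subseteq> R" "coll {} \<in> R"
    and app: "\<And>f a. f \<in> set [\<lambda>_. \<gamma>, q] \<Longrightarrow> a \<in> R \<Longrightarrow> f a \<in> R"
    by (rule ineffable_hull[OF assms _ small_elts[of \<kappa>]]) (rule that, assumption+)
  interpret small_embed \<kappa> \<theta> M j
    by fact
  have "\<gamma> \<in> R"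
    using app[of "\<lambda>_. \<gamma>"] R(3) by simp
  then have "elts \<gamma> \<subseteq> j ` elts M"
    using image_mem_\<kappa>_subset R(1) \<gamma>(1) by blast
  moreover have "elts \<gamma> \<subseteq> elts \<kappa>"
    using Ord_trans[OF _ \<gamma>(1)] \<open>Card \<kappa>\<close> by (simp add: Card_def)
  ultimately have "elts \<gamma> \<subseteq> R"
    using R(2) by blast
  then have "X \<subseteq> R"
    using app[of q] q by auto
  then have "X \<subseteq> j ` elts M \<inter> elts \<kappa>"
    using X R(1) by simp
  moreover obtain \<kappa>' where "\<kappa>' \<in> elts \<kappa>" "j ` elts M \<inter> elts \<kappa> = elts \<kappa>'"
    by (rule image_Int_\<kappa>)
  ultimately show "\<exists>\<beta>\<in>elts \<kappa>. X \<subseteq> elts \<beta>"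
    by (intro bexI[of _ \<kappa>']) simp_all
qed

text \<open>Since \<open>N\<close> is transitive, the set given by the relativized axiom has exactly
  the intended elements.\<close>

lemma separation_in_model:
  assumes "ZFC_minus_model N" "trans_class N" "a \<in> N" "range s \<subseteq> N"
  shows "coll {x \<in> elts a. sat N \<phi> (s(0 := x))} \<in> N"
proof -
  have sep: "\<forall>\<phi> s. range s \<subseteq> N \<longrightarrow>
      (\<forall>a\<in>N. \<exists>b\<in>N. \<forall>x\<in>N. x \<in> elts b \<longleftrightarrow> x \<in> elts a \<and> sat N \<phi> (s(0 := x)))"
    using assms(1) unfolding ZFC_minus_model_def by (elim conjE)
  then obtain b where b: "b \<in> N"
      "\<And>x. x \<in> N \<Longrightarrow> x \<in> elts b \<longleftrightarrow> x \<in> elts a \<and> sat N \<phi> (s(0 := x))"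
    using assms(3,4) by meson
  have "elts b \<subseteq> N" "elts a \<subseteq> N"
    using assms(2,3) b(1) by (auto simp: trans_class_def)
  then have "elts b = {x \<in> elts a. sat N \<phi> (s(0 := x))}"
    using b(2) by blast
  then show ?thesis
    using b(1) coll_elts[of b] by simp
qed

text \<open>\<open>up\<close> and \<open>cov\<close> are Skolem functions for directedness and
  cofinality. A hull closed under them contains a directed part of the club that covers the points
  of the hull.\<close>

lemma club_cofinal:
  assumes "club \<kappa> X C" "infinite (elts \<kappa>)"
  obtains up cov where
    "\<And>c c'. c \<in> C \<Longrightarrow> c' \<in> C \<Longrightarrow> up c c' \<in> C \<and> elts c \<union> elts c' \<subseteq> elts (up c c')"
    "\<And>a. a \<in> X \<Longrightarrow> cov a \<in> C \<and> a \<in> elts (cov a)"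
proof -
  have C: "C \<subseteq> Pk \<kappa> X" "\<And>a. a \<in> Pk \<kappa> X \<Longrightarrow> \<exists>c\<in>C. elts a \<subseteq> elts c"
    using assms(1) by (auto simp: club_def)
  have up: "\<exists>c''. c'' \<in> C \<and> elts c \<union> elts c' \<subseteq> elts c''" if "c \<in> C" "c' \<in> C" for c c'
  proof -
    have "coll (elts c \<union> elts c') \<in> Pk \<kappa> X"
      using that C(1) Un_lesspoll[OF assms(2)] by (auto simp: Pk_def)
    then show ?thesis
      using C(2)[of "coll (elts c \<union> elts c')"] by auto
  qed
  have cov: "\<exists>c. c \<in> C \<and> a \<in> elts c" if "a \<in> X" for a
  proof -
    have "coll {a} \<in> Pk \<kappa> X"
      using that finite_lesspoll_infinite[OF assms(2), of "{a}"] by (simp add: Pk_def)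
    then show ?thesis
      using C(2)[of "coll {a}"] by auto
  qed
  show thesis
    by (rule that[of "\<lambda>c c'. SOME c''. c'' \<in> C \<and> elts c \<union> elts c' \<subseteq> elts c''" "\<lambda>a. SOME c. c \<in> C \<and> a \<in> elts c"])
      (rule someI_ex[OF up] someI_ex[OF cov]; assumption)+
qed

text \<open>The members of \<open>C\<close> in \<open>R\<close> form a directed family covering
  \<open>X \<inter> R\<close>. Being small, each of them is included in \<open>R\<close>, so the
  union of the family is too, and \<open>club_directed\<close> finds \<open>Y\<close> inside
  it.\<close>

lemma club_meets_hull:
  assumes "club \<kappa> X C" "Card \<kappa>"
    and up: "\<And>c c'. c \<in> C \<inter> R \<Longrightarrow> c' \<in> C \<inter> R \<Longrightarrow> up c c' \<in> C \<inter> R \<and> elts c \<union> elts c' \<subseteq> elts (up c c')"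
    and cov: "\<And>a. a \<in> X \<inter> R \<Longrightarrow> cov a \<in> C \<inter> R \<and> a \<in> elts (cov a)"
    and small: "\<And>c. c \<in> R \<Longrightarrow> elts c \<prec> elts \<kappa> \<Longrightarrow> elts c \<subseteq> R"
    and A: "A \<subseteq> X \<inter> R" "A \<prec> elts \<kappa>" "A \<noteq> {}"
  obtains Y where "Y \<in> C" "A \<subseteq> elts Y" "elts Y \<subseteq> R"
proof -
  have C: "C \<subseteq> Pk \<kappa> X"
    using assms(1) by (simp add: club_def)
  have "\<exists>c''\<in>C \<inter> R. elts c \<union> elts c' \<subseteq> elts c''" if "c \<in> C \<inter> R" "c' \<in> C \<inter> R" for c c'
    using up[OF that] by blast
  moreover have "A \<subseteq> (\<Union>c\<in>C \<inter> R. elts c)" "C \<inter> R \<noteq> {}"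
    using A(1,3) cov by blast+
  ultimately obtain Y where Y: "Y \<in> C" "A \<subseteq> elts Y" "elts Y \<subseteq> (\<Union>c\<in>C \<inter> R. elts c)"
    using club_directed[OF assms(1,2), of "C \<inter> R" A] A(2) by (metis inf_le1)
  have "elts c \<subseteq> R" if "c \<in> C \<inter> R" for c
    using small[of c] that C by (auto simp: Pk_def)
  then show thesis
    using that Y by blast
qed


section \<open>The principle ISP\<close>

text \<open>Skolem functions for smallness: if a hull contains \<open>a\<close>, it contains the
  ordinal \<open>sz a\<close> below \<open>\<kappa>\<close>, then the elements of that ordinal, and
  through \<open>h\<close> all elements of \<open>a\<close>.\<close>

lemma small_enumeration:
  fixes \<kappa> :: "'v::zfc"
  assumes "Ord \<kappa>"
  obtains sz and h :: "'v \<Rightarrow> 'v \<Rightarrow> 'v"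
  where "\<And>a. elts a \<prec> elts \<kappa> \<Longrightarrow> sz a \<in> elts \<kappa> \<and> h a ` elts (sz a) = elts a"
proof -
  have "\<forall>a::'v. \<exists>p. elts a \<prec> elts \<kappa> \<longrightarrow> fst p \<in> elts \<kappa> \<and> snd p ` elts (fst p) = elts a" (is "\<forall>a. ?Q a")
  proof
    fix a
    show "?Q a"
    proof (cases "elts a \<prec> elts \<kappa>")
      case True
      then obtain \<gamma> where \<gamma>: "\<gamma> \<in> elts \<kappa>" "elts a \<approx> elts \<gamma>"
        by (rule lesspoll_Ord_eqpoll[OF assms])
      then obtain q where "q ` elts \<gamma> = elts a"
        by (meson bij_betw_def eqpoll_def eqpoll_sym)
      then show ?thesis
        using \<gamma>(1) by (intro exI[of _ "(\<gamma>, q)"]) simp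
    qed simp
  qed
  from choice[OF this] obtain p where "\<And>a::'v. elts a \<prec> elts \<kappa> \<longrightarrow> fst (p a) \<in> elts \<kappa> \<and> snd (p a) ` elts (fst (p a)) = elts a"
    by blast
  then show thesis
    using that[of "\<lambda>a. fst (p a)" "\<lambda>a. snd (p a)"] by blast
qed

text \<open>
  The functions \<open>W\<close> and \<open>W'\<close> pick a counterexample to injectivity: if a member \<open>j c\<close> of the
  range had one, it could be pulled back to \<open>c\<close>.
\<close>

lemma non_injectivity_witnesses:
  fixes f :: "'v::zfc \<Rightarrow> 'v"
  obtains W W' :: "'v \<Rightarrow> 'v"
  where "\<And>x. \<not> inj_on f (elts x) \<Longrightarrow> W x \<in> elts x \<and> W' x \<in> elts x \<and> W x \<noteq> W' x \<and> f (W x) = f (W' x)"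
proof -
  have "\<forall>x. \<exists>p. \<not> inj_on f (elts x) \<longrightarrow>
      fst p \<in> elts x \<and> snd p \<in> elts x \<and> fst p \<noteq> snd p \<and> f (fst p) = f (snd p)"
    by (simp add: inj_on_def) blast
  from choice[OF this] obtain p where "\<And>x. \<not> inj_on f (elts x) \<longrightarrow>
      fst (p x) \<in> elts x \<and> snd (p x) \<in> elts x \<and> fst (p x) \<noteq> snd (p x) \<and> f (fst (p x)) = f (snd (p x))"
    by blast
  then show thesis
    using that[of "\<lambda>x. fst (p x)" "\<lambda>x. snd (p x)"] by blast
qed

text \<open>By contradiction, for the sake of the order of choices: the set \<open>j E\<close> is
  known only after the embedding, whereas Skolem functions for a club that refutes it have to be in
  the range beforehand. Failure of the conclusion provides such a club for every \<open>D\<close> at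
  once.\<close>

lemma ISP_of_ineffable:
  fixes \<kappa> \<mu> :: "'v::zfc"
  assumes \<mu>: "Card \<mu>" "elts \<kappa> \<subseteq> elts \<mu>" and ineffable: "internally_AP_ineffable \<kappa> \<mu>"
    and slender: "slender \<kappa> \<mu> d"
  shows "\<exists>D. elts D \<subseteq> elts \<mu> \<and>
    stationary \<kappa> (elts \<mu>) {a \<in> Pk \<kappa> (elts \<mu>). elts (d a) = elts D \<inter> elts a}"
proof (rule ccontr)
  assume neg: "\<not> ?thesis"
  have \<kappa>: "Card \<kappa>" "Ord \<kappa>" "uncountable (elts \<kappa>)" "infinite (elts \<kappa>)"
    using ineffable_Card[OF ineffable] ineffable_uncountable[OF ineffable] countable_finite
    by (auto simp: Card_def)
  have inf_\<mu>: "infinite (elts \<mu>)"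
    using \<kappa>(4) \<mu>(2) finite_subset by blast

  \<comment> \<open>Clubs refuting each candidate set, with Skolem functions uniform in the
    candidate\<close>
  have "\<forall>D. \<exists>C. elts D \<subseteq> elts \<mu> \<longrightarrow> club \<kappa> (elts \<mu>) C \<and> (\<forall>a\<in>C. elts (d a) \<noteq> elts D \<inter> elts a)" (is "\<forall>D. ?Q D")
  proof
    fix D
    show "?Q D"
    proof (cases "elts D \<subseteq> elts \<mu>")
      case True
      then have "\<not> stationary \<kappa> (elts \<mu>) {a \<in> Pk \<kappa> (elts \<mu>). elts (d a) = elts D \<inter> elts a}"
        using neg by simp
      then obtain C where C: "club \<kappa> (elts \<mu>) C"
          "{a \<in> Pk \<kappa> (elts \<mu>). elts (d a) = elts D \<inter> elts a} \<inter> C = {}"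
        unfolding stationary_def by blast
      then have "C \<subseteq> Pk \<kappa> (elts \<mu>)"
        by (simp add: club_def)
      then show ?thesis
        using C by blast
    qed simp
  qed
  from choice[OF this] obtain Cl where Cl: "\<And>D. elts D \<subseteq> elts \<mu> \<longrightarrow>
      club \<kappa> (elts \<mu>) (Cl D) \<and> (\<forall>a\<in>Cl D. elts (d a) \<noteq> elts D \<inter> elts a)"
    by blast
  have "\<forall>D. \<exists>p. elts D \<subseteq> elts \<mu> \<longrightarrow>
      (\<forall>c c'. c \<in> Cl D \<longrightarrow> c' \<in> Cl D \<longrightarrow> fst p c c' \<in> Cl D \<and> elts c \<union> elts c' \<subseteq> elts (fst p c c')) \<and>
      (\<forall>a\<in>elts \<mu>. snd p a \<in> Cl D \<and> a \<in> elts (snd p a))" (is "\<forall>D. ?Q D")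
  proof
    fix D
    show "?Q D"
    proof (cases "elts D \<subseteq> elts \<mu>")
      case True
      then have "club \<kappa> (elts \<mu>) (Cl D)"
        using Cl by blast
      then obtain up cov where
        "\<And>c c'. c \<in> Cl D \<Longrightarrow> c' \<in> Cl D \<Longrightarrow> up c c' \<in> Cl D \<and> elts c \<union> elts c' \<subseteq> elts (up c c')"
        "\<And>a. a \<in> elts \<mu> \<Longrightarrow> cov a \<in> Cl D \<and> a \<in> elts (cov a)"
        by (rule club_cofinal[OF _ \<kappa>(4)]) (rule that, assumption+)
      then show ?thesis
        by (intro exI[of _ "(up, cov)"]) simp
    qed simp
  qed
  from choice[OF this] obtain q where q: "\<And>D. elts D \<subseteq> elts \<mu> \<longrightarrow>
      (\<forall>c c'. c \<in> Cl D \<longrightarrow> c' \<in> Cl D \<longrightarrow> fst (q D) c c' \<in> Cl D \<and> elts c \<union> elts c' \<subseteq> elts (fst (q D) c c')) \<and>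
      (\<forall>a\<in>elts \<mu>. snd (q D) a \<in> Cl D \<and> a \<in> elts (snd (q D) a))"
    by blast
  define up2 where "up2 D = fst (q D)" for D
  define cov2 where "cov2 D = snd (q D)" for D
  have up2: "up2 D c c' \<in> Cl D \<and> elts c \<union> elts c' \<subseteq> elts (up2 D c c')"
    if "elts D \<subseteq> elts \<mu>" "c \<in> Cl D" "c' \<in> Cl D" for D c c'
    using q that by (simp add: up2_def)
  have cov2: "cov2 D a \<in> Cl D \<and> a \<in> elts (cov2 D a)"
    if "elts D \<subseteq> elts \<mu>" "a \<in> elts \<mu>" for D a
    using q that by (simp add: cov2_def)

  \<comment> \<open>The club given by slenderness\<close>
  have d: "Pk_list \<kappa> \<mu> d"
    using slender by (simp add: slender_def)
  obtain \<alpha> where \<alpha>: "Ord \<alpha>" and sl: "\<forall>\<theta>. Card \<theta> \<and> \<alpha> \<in> elts \<theta> \<longrightarrow>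
        (\<exists>C. club \<kappa> (H \<theta>) C \<and>
           (\<forall>X\<in>C. \<forall>b\<in>elts X \<inter> Pk omega1 (elts \<mu>).
              coll (elts b \<inter> elts (d (coll (elts X \<inter> elts \<mu>)))) \<in> elts X))"
    using slender unfolding slender_def by (elim exE conjE) (rule that)
  \<comment> \<open>\<open>\<theta>1\<close> is fixed before the embedding and is independent of the
    later \<open>\<theta>\<close>; the club \<open>C1\<close> acts on the hull through
    \<open>up1\<close> and \<open>cov1\<close>. With \<open>\<mu>\<close> in
    \<open>H \<theta>1\<close>, all subsets of \<open>\<mu>\<close> are there too.\<close>
  have "small (trans_closure \<mu> \<union> elts \<alpha>)"
    by (intro small_Un small_trans_closure small_elts)
  then obtain \<theta>1 :: 'v where \<theta>1: "regular \<theta>1" "trans_closure \<mu> \<union> elts \<alpha> \<prec> elts \<theta>1"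
      "\<And>\<beta>. Ord \<beta> \<Longrightarrow> elts \<beta> \<subseteq> trans_closure \<mu> \<union> elts \<alpha> \<Longrightarrow> \<beta> \<in> elts \<theta>1"
    by (rule regular_exists) (rule that, assumption+)
  have \<mu>H: "\<mu> \<in> H \<theta>1"
    unfolding H_def using subset_lesspoll[OF Un_upper1 \<theta>1(2)] by simp
  have "\<alpha> \<in> elts \<theta>1" "Card \<theta>1"
    using \<theta>1(1,3) \<alpha> by (simp_all add: regular_def)
  then obtain C1 where C1: "club \<kappa> (H \<theta>1) C1"
    and sl1: "\<And>X b. X \<in> C1 \<Longrightarrow> b \<in> elts X \<Longrightarrow> b \<in> Pk omega1 (elts \<mu>) \<Longrightarrow>
      coll (elts b \<inter> elts (d (coll (elts X \<inter> elts \<mu>)))) \<in> elts X"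
    using sl by blast
  obtain up1 cov1 where
    up1: "\<And>c c'. c \<in> C1 \<Longrightarrow> c' \<in> C1 \<Longrightarrow> up1 c c' \<in> C1 \<and> elts c \<union> elts c' \<subseteq> elts (up1 c c')" and
    cov1: "\<And>a. a \<in> H \<theta>1 \<Longrightarrow> cov1 a \<in> C1 \<and> a \<in> elts (cov1 a)"
    by (rule club_cofinal[OF C1 \<kappa>(4)]) (rule that, assumption+)

  \<comment> \<open>Functions for coding and decoding enumerations\<close>
  obtain sz h where sz: "\<And>a :: 'v. elts a \<prec> elts \<kappa> \<Longrightarrow> sz a \<in> elts \<kappa> \<and> h a ` elts (sz a) = elts a"
    by (rule small_enumeration[OF \<kappa>(2)]) (rule that, assumption)
  obtain p :: "'v \<Rightarrow> 'v \<times> 'v" where p: "bij_betw p (elts \<mu>) (elts \<mu> \<times> elts omega)"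
    by (rule bij_betw_times_omega[OF inf_\<mu>])
  define P where "P \<xi> n = inv_into (elts \<mu>) p (\<xi>, n)" for \<xi> n
  define P1 where "P1 z = snd (p z)" for z
  have P: "P \<xi> n \<in> elts \<mu>" "p (P \<xi> n) = (\<xi>, n)" if "\<xi> \<in> elts \<mu>" "n \<in> elts omega" for \<xi> n
    using that p by (auto simp: P_def bij_betw_def intro: inv_into_into f_inv_into_f)
  have P1: "P1 z \<in> elts omega" if "z \<in> elts \<mu>" for z
    using that p unfolding P1_def by (metis bij_betwE mem_Times_iff)
  obtain W W' :: "'v \<Rightarrow> 'v" where W: "\<And>x. \<not> inj_on P1 (elts x) \<Longrightarrow>
      W x \<in> elts x \<and> W' x \<in> elts x \<and> W x \<noteq> W' x \<and> P1 (W x) = P1 (W' x)"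
    by (rule non_injectivity_witnesses) (rule that, assumption)
  \<comment> \<open>If \<open>J\<close> codes a set of pairs by elements of \<open>\<mu>\<close>,
    then \<open>Im J\<close> is the set of their first coordinates.\<close>
  define Im where "Im J = coll {y \<in> elts \<mu>. \<exists>n\<in>elts omega. P y n \<in> elts J}" for J
  have elts_Im: "elts (Im J) = {y \<in> elts \<mu>. \<exists>n\<in>elts omega. P y n \<in> elts J}" for J
    unfolding Im_def by (rule elts_coll, rule small_subset[OF small_elts]) blast
  define PD where "PD = (\<Union>\<xi>\<in>elts \<mu>. opair \<xi> ` elts omega)"
  have "small PD"
    unfolding PD_def by (intro small_opairs small_elts)
  define Pg where "Pg = graph PD (\<lambda>q. P (opair_fst q) (opair_snd q))"
  define P1g where "P1g = graph (elts \<mu>) P1"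
  define A where "A = elts \<kappa> \<union> elts \<mu> \<union> {z. elts z \<subseteq> elts \<mu>}"
  have "small A"
    unfolding A_def by (intro small_Un small_Pow small_elts)
  define fs where "fs = [sz, \<lambda>r. h (opair_fst r) (opair_snd r), \<lambda>r. up1 (opair_fst r) (opair_snd r), cov1,
      \<lambda>r. up2 (opair_fst r) (opair_fst (opair_snd r)) (opair_snd (opair_snd r)), \<lambda>r. cov2 (opair_fst r) (opair_snd r),
      W, W', Im, \<lambda>_. Pg, \<lambda>_. P1g, \<lambda>_. omega]"

  \<comment> \<open>The embedding and the closure properties of its hull\<close>
  obtain \<theta> j M \<delta> N R where
    emb: "small_embed \<kappa> \<theta> M j" and \<delta>: "\<delta> \<in> elts M" "\<delta> \<in> elts \<kappa>" "j \<delta> = \<mu>"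
    and N: "trans_class N" "ZFC_minus_model N" "omega1_approximation N (H \<theta>)" "M \<in> N" and MH: "M \<in> H \<theta>"
    and count: "\<And>b. b \<in> N \<Longrightarrow> elts b \<subseteq> elts \<delta> \<Longrightarrow> countable_in N b \<Longrightarrow> b \<in> elts M"
    and ineff: "coll {\<xi> \<in> elts M. j \<xi> \<in> elts (d (coll (j ` elts \<delta>)))} \<in> N \<Longrightarrow>
      coll {\<xi> \<in> elts M. j \<xi> \<in> elts (d (coll (j ` elts \<delta>)))} \<in> elts M"
    and R: "R \<subseteq> j ` elts M" "A \<inter> j ` elts M \<subseteq> R" "coll {} \<in> R"
    and pair: "\<And>a b. a \<in> R \<Longrightarrow> b \<in> R \<Longrightarrow> opair a b \<in> R"
    and app: "\<And>f a. f \<in> set fs \<Longrightarrow> a \<in> R \<Longrightarrow> f a \<in> R"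
    by (rule ineffable_hull[OF ineffable d \<open>small A\<close>, where fs = fs]) (rule that, assumption+)
  interpret small_embed \<kappa> \<theta> M j
    by (rule emb)
  have sz_R: "sz a \<in> R" and cov1_R: "cov1 a \<in> R" and W_R: "W a \<in> R" "W' a \<in> R" and Im_R: "Im a \<in> R"
    if "a \<in> R" for a
    using that app[OF _ that] by (simp_all add: fs_def)
  have h_R: "h a b \<in> R" and up1_R: "up1 a b \<in> R" and cov2_R: "cov2 a b \<in> R"
    if "a \<in> R" "b \<in> R" for a b
    using app[OF _ pair[OF that], of "\<lambda>r. h (opair_fst r) (opair_snd r)"]
      app[OF _ pair[OF that], of "\<lambda>r. up1 (opair_fst r) (opair_snd r)"]
      app[OF _ pair[OF that], of "\<lambda>r. cov2 (opair_fst r) (opair_snd r)"] by (simp_all add: fs_def)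
  have up2_R: "up2 a b c \<in> R" if "a \<in> R" "b \<in> R" "c \<in> R" for a b c
    using app[OF _ pair[OF that(1) pair[OF that(2,3)]],
        of "\<lambda>r. up2 (opair_fst r) (opair_fst (opair_snd r)) (opair_snd (opair_snd r))"] by (simp add: fs_def)
  have const_R: "Pg \<in> R" "P1g \<in> R" "omega \<in> R"
    using app[OF _ R(3), of "\<lambda>_. Pg"] app[OF _ R(3), of "\<lambda>_. P1g"] app[OF _ R(3), of "\<lambda>_. omega"]
    by (simp_all add: fs_def)
  have small_R: "elts c \<subseteq> R" if c: "c \<in> R" "elts c \<prec> elts \<kappa>" for c
  proof -
    have "elts (sz c) \<subseteq> elts \<kappa>"
      using sz[OF c(2)] Ord_trans[OF \<kappa>(2)] by blast
    moreover have "elts (sz c) \<subseteq> j ` elts M"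
      using image_mem_\<kappa>_subset[of "sz c"] sz_R[OF c(1)] R(1) sz[OF c(2)] by blast
    ultimately have "elts (sz c) \<subseteq> R"
      using R(2) by (auto simp: A_def)
    then have "h c ` elts (sz c) \<subseteq> R"
      using h_R[OF c(1)] by blast
    then show ?thesis
      using sz[OF c(2)] by simp
  qed
  have "elts (omega :: 'v) \<prec> elts \<kappa>"
    using \<kappa>(3) countable_omega countable_lepoll not_lepoll_iff by blast
  then have omega_R: "elts omega \<subseteq> R"
    by (rule small_R[OF const_R(3)])
  have omega_\<kappa>: "elts (omega :: 'v) \<subseteq> elts \<kappa>"
  proof
    fix n :: 'v assume "n \<in> elts omega"
    then have n: "Ord n" "finite (elts n)"
      by (simp_all add: elts_omega)
    then have "\<not> elts \<kappa> \<subseteq> elts n"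
      using \<kappa>(4) finite_subset by blast
    then show "n \<in> elts \<kappa>"
      using Ord_linear[OF n(1) \<kappa>(2)] Ord_trans[OF n(1), of \<kappa>] by blast
  qed
  have omega_fixed: "n \<in> elts M" "j n = n" if "n \<in> elts omega" for n
    using fixed_below_\<kappa>[of n] omega_R omega_\<kappa> R(1) that by blast+
  have \<delta>M: "elts \<delta> \<subseteq> elts M"
    using M_trans[OF \<delta>(1)] by blast
  have j_\<mu>_iff: "j \<xi> \<in> elts \<mu> \<longleftrightarrow> \<xi> \<in> elts \<delta>" if "\<xi> \<in> elts M" for \<xi>
    using j_mem_iff[OF that \<delta>(1)] \<delta>(3) by simp
  have R_\<mu>: "R \<inter> elts \<mu> = j ` elts \<delta>"
  proof
    show "R \<inter> elts \<mu> \<subseteq> j ` elts \<delta>"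
      using R(1) j_\<mu>_iff by blast
    show "j ` elts \<delta> \<subseteq> R \<inter> elts \<mu>"
      using R(2) j_\<mu>_iff \<delta>M by (auto simp: A_def)
  qed

  \<comment> \<open>The point \<open>j[\<delta>]\<close> and the pulled back list entry
    \<open>E\<close>\<close>
  define a0 where "a0 = coll (j ` elts \<delta>)"
  have elts_a0: "elts a0 = j ` elts \<delta>"
    by (simp add: a0_def)
  have a0_less: "j ` elts \<delta> \<prec> elts \<kappa>"
    using lesspoll_trans1[OF image_lepoll Card_mem_lesspoll[OF \<kappa>(1) \<delta>(2)]] .
  have a0_ne: "j ` elts \<delta> \<noteq> {}"
  proof -
    have "coll {} \<in> j ` elts M"
      using R(1,3) by blast
    moreover have "coll {} \<in> elts (omega :: 'v)"
      by (simp add: elts_omega Ord_def trans_class_def)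
    ultimately have "coll {} \<in> R \<inter> elts \<mu>"
      using R(3) omega_\<kappa> \<mu>(2) by blast
    then show ?thesis
      unfolding R_\<mu> by blast
  qed
  have a0_Pk: "a0 \<in> Pk \<kappa> (elts \<mu>)"
    using a0_less R_\<mu> by (auto simp: Pk_def elts_a0)
  then have d_a0: "elts (d a0) \<subseteq> j ` elts \<delta>"
    using d elts_a0 by (auto simp: Pk_list_def)
  define E where "E = coll {\<xi> \<in> elts M. j \<xi> \<in> elts (d a0)}"
  have elts_E: "elts E = {\<xi> \<in> elts M. j \<xi> \<in> elts (d a0)}"
    unfolding E_def by (rule elts_coll, rule small_subset[OF small_elts[of M]]) blast
  have E_\<delta>: "elts E \<subseteq> elts \<delta>"
    using d_a0 R_\<mu> j_\<mu>_iff elts_E by blast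
  have MN: "elts M \<subseteq> N"
    using N(1,4) by (auto simp: trans_class_def)
  obtain pg where pg: "pg \<in> elts M" "j pg = Pg"
    using const_R(1) R(1) by blast
  obtain p1g where p1g: "p1g \<in> elts M" "j p1g = P1g"
    using const_R(2) R(1) by blast

  \<comment> \<open>Traces of \<open>E\<close> on sets that are countable in
    \<open>N\<close>\<close>
  have approx: "coll (elts E \<inter> elts x) \<in> N" if x: "x \<in> N" "countable_in N x" for x
  proof -
    obtain f where f: "inj_on f (elts x)" "f ` elts x \<subseteq> elts omega" "graph (elts x) f \<in> N"
      using x(2) by (auto simp: countable_in_def)
    define F where "F = graph (elts x) f"
    \<comment> \<open>\<open>c\<close> codes the restriction of \<open>f\<close> to
      \<open>x \<inter> \<delta>\<close> through \<open>pg\<close>, the preimage of the pairing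
      function. The enumeration is coded along with the set because countability of the image under
      \<open>j\<close> has to be derived from it.\<close>
    define c where "c = coll {z \<in> elts \<delta>. \<exists>q\<in>elts F. opair q z \<in> elts pg}"
    have elts_c: "elts c = {z \<in> elts \<delta>. \<exists>q\<in>elts F. opair q z \<in> elts pg}"
      unfolding c_def by (rule elts_coll, rule small_subset[OF small_elts[of \<delta>]]) blast
    have "c \<in> N"
    proof -
      \<comment> \<open>Variable 0 is the candidate, 1 is \<open>F\<close>, 2 defaults to
        \<open>pg\<close>; 3 and 4 are the pair from \<open>F\<close> and its entry in
        \<open>pg\<close>.\<close>
      let ?s = "(\<lambda>_. pg)(1 := F)"
      let ?\<phi> = "Exists 3 (And (Mem 3 1) (Exists 4 (And (Mem 4 2) (opair_fm 4 3 0))))"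
      have FN: "elts F \<subseteq> N" and pgN: "elts pg \<subseteq> N"
        using f(3) N(1) pg(1) MN by (auto simp: trans_class_def F_def)
      have "sat N ?\<phi> (?s(0 := z)) \<longleftrightarrow> (\<exists>q\<in>elts F. opair q z \<in> elts pg)" for z
        using FN pgN N(1) by auto
      then have "c = coll {z \<in> elts \<delta>. sat N ?\<phi> (?s(0 := z))}"
        unfolding c_def by presburger
      moreover have "range ?s \<subseteq> N" "\<delta> \<in> N"
        using f(3) pg(1) \<delta>(1) MN by (auto simp: F_def)
      ultimately show ?thesis
        using separation_in_model[OF N(2,1)] by metis
    qed
    have c_\<delta>: "elts c \<subseteq> elts \<delta>"
      using elts_c by blast
    \<comment> \<open>Together with \<open>cI\<close>: the values of \<open>j\<close> on
      \<open>c\<close> are exactly the codes of the pairs \<open>(j a, f a)\<close> with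
      \<open>a\<close> in \<open>x \<inter> \<delta>\<close>. Elementarity turns \<open>pg\<close>
      into \<open>Pg\<close>, and \<open>j\<close> fixes the natural number
      \<open>f a\<close>.\<close>
    have cD: "\<exists>a\<in>elts x \<inter> elts \<delta>. j z = P (j a) (f a)" if z: "z \<in> elts c" for z
    proof -
      obtain q where q: "q \<in> elts F" "opair q z \<in> elts pg"
        using z elts_c by blast
      obtain a where a: "a \<in> elts x" "q = opair a (f a)"
        using q(1) unfolding F_def by (rule graph_cases[OF small_elts])
      have qz: "opair q z \<in> elts M"
        using M_trans[OF pg(1) q(2)] .
      then have "coll {q} \<in> elts M"
        using M_trans[OF qz] by (simp add: elts_opair)
      then have q_M: "q \<in> elts M"
        using M_trans[of "coll {q}" q] by simp
      then have "coll {a, f a} \<in> elts M"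
        using M_trans[OF q_M] a(2) by (simp add: elts_opair)
      then have aM: "a \<in> elts M"
        using M_trans[of "coll {a, f a}" a] by simp
      have fa: "f a \<in> elts omega"
        using f(2) a(1) by blast
      have zM: "z \<in> elts M"
        using z c_\<delta> \<delta>M by blast
      have "j (opair q z) \<in> elts Pg"
        using j_mem_iff[OF qz pg(1)] q(2) pg(2) by simp
      moreover have "j (opair q z) = opair (opair (j a) (f a)) (j z)"
        using j_opair(2)[OF q_M zM] j_opair(2)[OF aM omega_fixed(1)[OF fa]] omega_fixed(2)[OF fa] a(2)
        by simp
      ultimately have "opair (j a) (f a) \<in> PD" "j z = P (j a) (f a)"
        using \<open>small PD\<close> by (simp_all add: Pg_def)
      then show ?thesis
        using j_\<mu>_iff[OF aM] a(1) by (auto simp: PD_def)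
    qed
    have cI: "\<exists>z\<in>elts c. j z = P (j a) (f a)" if a: "a \<in> elts x" "a \<in> elts \<delta>" for a
    proof -
      have fa: "f a \<in> elts omega"
        using f(2) a(1) by blast
      have aM: "a \<in> elts M"
        using a(2) \<delta>M by blast
      have ja: "j a \<in> elts \<mu>"
        using j_\<mu>_iff[OF aM] a(2) by simp
      let ?q = "opair a (f a)"
      have qM: "?q \<in> elts M" and jq: "j ?q = opair (j a) (f a)"
        using j_opair[OF aM omega_fixed(1)[OF fa]] omega_fixed(2)[OF fa] by simp_all
      have qD: "j ?q \<in> PD"
        using ja fa jq by (auto simp: PD_def)
      have "P (opair_fst (j ?q)) (opair_snd (j ?q)) \<in> j ` elts M"
        using graph_apply_in_image[OF \<open>small PD\<close>, of _ "j ?q"] const_R(1) R(1) qM qD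
        unfolding Pg_def by blast
      then obtain z where z: "z \<in> elts M" "j z = P (j a) (f a)"
        using jq by auto
      have "z \<in> elts \<delta>"
        using j_\<mu>_iff[OF z(1)] z(2) P(1)[OF ja fa] by simp
      moreover have "opair ?q z \<in> elts pg"
      proof -
        have "j (opair ?q z) \<in> elts Pg"
          using j_opair(2)[OF qM z(1)] qD jq z(2) \<open>small PD\<close> by (simp add: Pg_def)
        then show ?thesis
          using j_mem_iff[OF j_opair(1)[OF qM z(1)] pg(1)] pg(2) by simp
      qed
      moreover have "?q \<in> elts F"
        using a(1) by (simp add: F_def)
      ultimately show ?thesis
        using z(2) elts_c by blast
    qed
    have P1j: "\<exists>a\<in>elts x \<inter> elts \<delta>. j z = P (j a) (f a) \<and> P1 (j z) = f a" if z: "z \<in> elts c" for z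
    proof -
      obtain a where a: "a \<in> elts x \<inter> elts \<delta>" "j z = P (j a) (f a)"
        using cD[OF z] by blast
      then have "j a \<in> elts \<mu>" "f a \<in> elts omega"
        using j_\<mu>_iff \<delta>M f(2) by auto
      then have "P1 (j z) = f a"
        using a(2) P(2) by (simp add: P1_def)
      then show ?thesis
        using a by blast
    qed
    have c_inj: "z = z'" if z: "z \<in> elts c" "z' \<in> elts c" "P1 (j z) = P1 (j z')" for z z'
    proof -
      obtain a a' where "a \<in> elts x" "a' \<in> elts x" "j z = P (j a) (f a)" "j z' = P (j a') (f a')"
          "f a = f a'"
        using P1j[OF z(1)] P1j[OF z(2)] z(3) by auto
      then have "j z = j z'"
        using f(1) by (metis inj_onD)
      then show ?thesis
        using z c_\<delta> \<delta>M by (metis j_eq_iff subsetD)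
    qed
    \<comment> \<open>On \<open>c\<close> the map from \<open>z\<close> to \<open>P1 (j z)\<close>
      is the restriction of \<open>p1g\<close>, because \<open>j\<close> fixes natural numbers. So
      Separation in \<open>N\<close> yields its graph from the parameters \<open>p1g\<close> and
      \<open>c\<close>, without mention of \<open>j\<close>.\<close>
    have "countable_in N c"
      unfolding countable_in_def
    proof (intro exI conjI)
      show "inj_on (\<lambda>z. P1 (j z)) (elts c)"
        using c_inj by (intro inj_onI)
      show g_omega: "(\<lambda>z. P1 (j z)) ` elts c \<subseteq> elts omega"
        using P1j f(2) by force
      let ?s = "\<lambda>_::nat. c"
      let ?\<phi> = "Exists 3 (And (Mem 3 1) (Exists 4 (opair_fm 0 3 4)))"
      have cN: "elts c \<subseteq> N"
        using \<open>c \<in> N\<close> N(1) by (auto simp: trans_class_def)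
      have p1gN: "elts p1g \<subseteq> elts M"
        using M_trans[OF p1g(1)] by blast
      have j_P1: "opair z n \<in> elts p1g \<longleftrightarrow> n = P1 (j z)" if z: "z \<in> elts c" and nM: "n \<in> elts M" for z n
      proof -
        have zM: "z \<in> elts M"
          using z c_\<delta> \<delta>M by blast
        have g: "P1 (j z) \<in> elts omega"
          using g_omega z by blast
        have "opair z n \<in> elts p1g \<longleftrightarrow> opair (j z) (j n) \<in> elts P1g"
          using j_mem_iff[OF j_opair(1)[OF zM nM] p1g(1)] j_opair(2)[OF zM nM] p1g(2) by simp
        also have "\<dots> \<longleftrightarrow> j n = P1 (j z)"
          using j_\<mu>_iff[OF zM] z c_\<delta> by (auto simp: P1g_def)
        also have "\<dots> \<longleftrightarrow> n = P1 (j z)"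
          using j_eq_iff[OF nM omega_fixed(1)[OF g]] omega_fixed(2)[OF g] by simp
        finally show ?thesis .
      qed
      have "{r \<in> elts p1g. sat N ?\<phi> (?s(0 := r))} = (\<lambda>z. opair z (P1 (j z))) ` elts c"
      proof (intro equalityI subsetI)
        fix r assume r: "r \<in> {r \<in> elts p1g. sat N ?\<phi> (?s(0 := r))}"
        then have "r \<in> N" "r \<in> elts M"
          using p1gN MN by auto
        then obtain z n where zn: "z \<in> elts c" "r = opair z n"
          using r N(1) by auto
        have "coll {z, n} \<in> elts M"
          using M_trans[OF \<open>r \<in> elts M\<close>] zn(2) by (simp add: elts_opair)
        then have "n \<in> elts M"
          using M_trans[of "coll {z, n}" n] by simp
        then show "r \<in> (\<lambda>z. opair z (P1 (j z))) ` elts c"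
          using j_P1[OF zn(1)] r zn by auto
      next
        fix r assume "r \<in> (\<lambda>z. opair z (P1 (j z))) ` elts c"
        then obtain z where z: "z \<in> elts c" "r = opair z (P1 (j z))"
          by blast
        have "P1 (j z) \<in> elts M"
          using g_omega z(1) omega_fixed(1) by blast
        then have r: "r \<in> elts p1g" "P1 (j z) \<in> N"
          using j_P1[OF z(1)] z(2) MN by auto
        then have "r \<in> N"
          using p1gN MN by blast
        then have "sat N ?\<phi> (?s(0 := r))"
          using z r(2) cN N(1) by auto
        then show "r \<in> {r \<in> elts p1g. sat N ?\<phi> (?s(0 := r))}"
          using r(1) by blast
      qed
      then have "graph (elts c) (\<lambda>z. P1 (j z)) = coll {r \<in> elts p1g. sat N ?\<phi> (?s(0 := r))}"
        by (simp add: graph_def)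
      also have "\<dots> \<in> N"
        by (rule separation_in_model[OF N(2,1)]) (use p1g(1) MN \<open>c \<in> N\<close> in auto)
      finally show "graph (elts c) (\<lambda>z. P1 (j z)) \<in> N" .
    qed
    then have cM: "c \<in> elts M"
      using count \<open>c \<in> N\<close> c_\<delta> by blast

    \<comment> \<open>The image of the code and the countable set that it codes\<close>
    have J_\<mu>: "elts (j c) \<subseteq> elts \<mu>"
      using j_subset[OF cM \<delta>(1) c_\<delta>] \<delta>(3) by simp
    then have J_R: "j c \<in> R"
      using R(2) cM by (auto simp: A_def)
    have J_pull: "\<exists>z\<in>elts c. w = j z" if w: "w \<in> R" "w \<in> elts (j c)" for w
    proof -
      obtain z where "z \<in> elts M" "w = j z"
        using w(1) R(1) by blast
      then show ?thesis
        using w(2) j_mem_iff[OF _ cM] by blast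
    qed
    have J_inj: "inj_on P1 (elts (j c))"
    proof (rule ccontr)
      assume "\<not> ?thesis"
      note W = W[OF this]
      obtain z where z: "z \<in> elts c" "W (j c) = j z"
        using J_pull[OF W_R(1)[OF J_R]] W by blast
      obtain z' where z': "z' \<in> elts c" "W' (j c) = j z'"
        using J_pull[OF W_R(2)[OF J_R]] W by blast
      show False
        using c_inj[OF z(1) z'(1)] W z(2) z'(2) by simp
    qed
    \<comment> \<open>\<open>B\<close> stands for the image of \<open>x \<inter> \<delta>\<close>
      under \<open>j\<close>, but is decoded from \<open>j c\<close>: this makes it a member of the
      hull and its countability evident from that of \<open>j c\<close>.\<close>
    define B where "B = Im (j c)"
    have elts_B: "elts B = {y \<in> elts \<mu>. \<exists>n\<in>elts omega. P y n \<in> elts (j c)}"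
      by (simp add: B_def elts_Im)
    have B_R: "B \<in> R"
      unfolding B_def by (rule Im_R[OF J_R])
    have "countable (elts (j c))"
    proof (rule countable_image_inj_on[OF _ J_inj])
      show "countable (P1 ` elts (j c))"
        using P1 J_\<mu> by (intro countable_subset[OF _ countable_omega]) blast
    qed
    moreover have "elts B \<subseteq> (\<lambda>w. fst (p w)) ` elts (j c)"
    proof
      fix y assume "y \<in> elts B"
      then obtain n where "y \<in> elts \<mu>" "n \<in> elts omega" "P y n \<in> elts (j c)"
        using elts_B by blast
      then show "y \<in> (\<lambda>w. fst (p w)) ` elts (j c)"
        using P(2) by (intro image_eqI[of _ _ "P y n"]) auto
    qed
    ultimately have "countable (elts B)"
      by (meson countable_image countable_subset)
    moreover have B_\<mu>: "elts B \<subseteq> elts \<mu>"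
      using elts_B by blast
    ultimately have B_Pk: "B \<in> Pk omega1 (elts \<mu>)"
      by (simp add: Pk_def countable_lesspoll_omega1)
    \<comment> \<open>A code in \<open>j c\<close> with first coordinate \<open>j a\<close> is a
      value of the pairing function at arguments in the range, so it is \<open>j z\<close> for some
      \<open>z\<close>; elementarity puts \<open>z\<close> into \<open>c\<close>, and decoding
      returns \<open>a\<close>.\<close>
    have jB_iff: "j a \<in> elts B \<longleftrightarrow> a \<in> elts x \<inter> elts \<delta>" if aM: "a \<in> elts M" for a
    proof
      assume "j a \<in> elts B"
      then obtain n where n: "j a \<in> elts \<mu>" "n \<in> elts omega" "P (j a) n \<in> elts (j c)"
        using elts_B by blast
      have a\<delta>: "a \<in> elts \<delta>"
        using n(1) j_\<mu>_iff[OF aM] by simp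
      have q: "opair (j a) n = j (opair a n)" "opair a n \<in> elts M"
        using j_opair[OF aM omega_fixed(1)[OF n(2)]] omega_fixed(2)[OF n(2)] by simp_all
      have "opair (j a) n \<in> PD"
        using n by (auto simp: PD_def)
      then have "P (opair_fst (opair (j a) n)) (opair_snd (opair (j a) n)) \<in> j ` elts M"
        using graph_apply_in_image[OF \<open>small PD\<close>, of _ "opair (j a) n"] const_R(1) R(1) q
        unfolding Pg_def by blast
      then obtain z where z: "z \<in> elts M" "j z = P (j a) n"
        by auto
      then have "z \<in> elts c"
        using n(3) j_mem_iff[OF z(1) cM] by simp
      then obtain a' where a': "a' \<in> elts x" "a' \<in> elts \<delta>" "j z = P (j a') (f a')"
        using cD by blast
      have "p (P (j a') (f a')) = (j a', f a')"
        using a' j_\<mu>_iff \<delta>M f(2) by (intro P(2)) auto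
      moreover have "p (P (j a) n) = (j a, n)"
        using n by (intro P(2))
      ultimately have "j a = j a'"
        using z(2) a'(3) by (metis prod.inject)
      then have "a = a'"
        using aM a'(2) \<delta>M by auto
      then show "a \<in> elts x \<inter> elts \<delta>"
        using a' by simp
    next
      assume a: "a \<in> elts x \<inter> elts \<delta>"
      then obtain z where "z \<in> elts c" "j z = P (j a) (f a)"
        using cI by blast
      then have "P (j a) (f a) \<in> elts (j c)"
        using j_mem_iff[OF _ cM, of z] c_\<delta> \<delta>M by auto
      moreover have "f a \<in> elts omega" "j a \<in> elts \<mu>"
        using a f(2) j_\<mu>_iff[OF aM] by auto
      ultimately show "j a \<in> elts B"
        using elts_B by blast
    qed

    \<comment> \<open>Slenderness applied inside the range\<close>
    have "insert B (j ` elts \<delta>) \<subseteq> H \<theta>1 \<inter> R"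
      using H_subset[OF \<mu>H B_\<mu>] H_trans[OF \<mu>H] B_R R_\<mu> by blast
    moreover have "insert B (j ` elts \<delta>) \<prec> elts \<kappa>"
      by (rule insert_lesspoll[OF \<kappa>(4) a0_less])
    ultimately obtain X where X: "X \<in> C1" "insert B (j ` elts \<delta>) \<subseteq> elts X" "elts X \<subseteq> R"
      by (rule club_meets_hull[OF C1 \<kappa>(1), of R up1 cov1, rotated 3])
        (use up1 cov1 up1_R cov1_R small_R in auto)
    \<comment> \<open>\<open>X\<close> contains \<open>j[\<delta>]\<close> and lies in the hull,
      whose trace on \<open>\<mu>\<close> is \<open>j[\<delta>]\<close>. Hence slenderness at
      \<open>X\<close> speaks of the list entry at \<open>j[\<delta>]\<close>.\<close>
    have "elts X \<inter> elts \<mu> = j ` elts \<delta>"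
      using X(2,3) R_\<mu> by blast
    then have "coll (elts B \<inter> elts (d a0)) \<in> elts X"
      using sl1[OF X(1) _ B_Pk] X(2) by (simp add: a0_def)
    then have "coll (elts B \<inter> elts (d a0)) \<in> j ` elts M"
      using X(3) R(1) by (meson subsetD)
    then obtain y where y: "y \<in> elts M" "j y = coll (elts B \<inter> elts (d a0))"
      by (metis imageE)
    have "a \<in> elts y \<longleftrightarrow> a \<in> elts E \<inter> elts x" if "a \<in> elts M" for a
    proof -
      have "a \<in> elts y \<longleftrightarrow> j a \<in> elts B \<and> j a \<in> elts (d a0)"
        using j_mem_iff[OF that y(1)] y(2) by simp
      then show ?thesis
        using jB_iff[OF that] that E_\<delta> unfolding elts_E by blast
    qed
    then have "elts y = elts E \<inter> elts x"
      using M_trans[OF y(1)] E_\<delta> \<delta>M by blast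
    then have "coll (elts E \<inter> elts x) = y"
      using coll_elts[of y] by simp
    then show ?thesis
      using y(1) MN by auto
  qed

  \<comment> \<open>Membership of \<open>E\<close> in \<open>N\<close> and \<open>M\<close>, and the
    contradiction\<close>
  have "\<delta> \<in> H \<theta>"
    using H_trans[OF MH \<delta>(1)] .
  then have "E \<in> H \<theta>"
    by (rule H_subset[OF _ E_\<delta>])
  moreover have "\<exists>B\<in>N. elts E \<subseteq> elts B"
    using E_\<delta> \<delta>(1) MN by blast
  ultimately have "E \<in> N"
    using N(3) approx unfolding omega1_approximation_def by blast
  then have EM: "E \<in> elts M"
    using ineff unfolding E_def a0_def by blast
  have D_\<mu>: "elts (j E) \<subseteq> elts \<mu>"
    using j_subset[OF EM \<delta>(1) E_\<delta>] \<delta>(3) by simp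
  then have D_R: "j E \<in> R"
    using R(2) EM by (auto simp: A_def)
  have clubD: "club \<kappa> (elts \<mu>) (Cl (j E))" and disj: "\<And>a. a \<in> Cl (j E) \<Longrightarrow> elts (d a) \<noteq> elts (j E) \<inter> elts a"
    using Cl D_\<mu> by blast+
  \<comment> \<open>A member of the refuting club between \<open>j[\<delta>]\<close> and the hull
    can only be \<open>a0\<close>, where the list entry does agree with \<open>j E\<close>.\<close>
  have "j ` elts \<delta> \<subseteq> elts \<mu> \<inter> R"
    using R_\<mu> by blast
  then obtain Y where Y: "Y \<in> Cl (j E)" "j ` elts \<delta> \<subseteq> elts Y" "elts Y \<subseteq> R"
    by (rule club_meets_hull[OF clubD \<kappa>(1), of R "up2 (j E)" "cov2 (j E)", rotated 3])
      (use up2[OF D_\<mu>] cov2[OF D_\<mu>] up2_R[OF D_R] cov2_R[OF D_R] small_R a0_less a0_ne in auto)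
  have "elts Y \<subseteq> elts \<mu>"
    using Y(1) clubD by (auto simp: club_def Pk_def)
  then have "elts Y \<subseteq> elts a0"
    using Y(3) unfolding elts_a0 R_\<mu>[symmetric] by simp
  moreover have "elts a0 \<subseteq> elts Y"
    using Y(2) unfolding elts_a0 .
  ultimately have "Y = a0"
    by (metis elts_inject subset_antisym)
  moreover have "elts (d a0) = elts (j E) \<inter> elts a0"
  proof -
    have "j \<xi> \<in> elts (d a0) \<longleftrightarrow> j \<xi> \<in> elts (j E)" if "\<xi> \<in> elts \<delta>" for \<xi>
    proof -
      have "\<xi> \<in> elts M"
        using that \<delta>M by blast
      then show ?thesis
        using j_mem_iff[OF _ EM] by (simp add: elts_E)
    qed
    then show ?thesis
      using d_a0 unfolding elts_a0 by blast
  qed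
  ultimately show False
    using disj[OF Y(1)] by simp
qed

theorem lemma8p6:
  fixes \<kappa> \<mu> :: "'v::zfc"
  assumes "Card \<kappa>" and "Card \<mu>" and "\<kappa> \<in> elts \<mu> \<or> \<kappa> = \<mu>"
    and "internally_AP_ineffable \<kappa> \<mu>"
  shows "ISP \<kappa> \<mu>"
proof -
  have "elts \<kappa> \<subseteq> elts \<mu>"
    using assms(2,3) Ord_trans[of \<mu> \<kappa>] by (auto simp: Card_def)
  then show ?thesis
    unfolding ISP_def
    using ineffable_regular[OF assms(4)] ineffable_uncountable[OF assms(4)]
      ISP_of_ineffable[OF assms(2) _ assms(4)] by blast
qed

end
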